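(* For every constant $c_1>0$ there exist positive constants $c_4,c_5,c_5',c_6$ and $n_0$, depending only on $c_1$, such that for every $n\ge n_0$ the following holds: if $P\subset\mathbb{R}^2$ is a set of $n$ points determining at least $c_1 n^{4/3}$ unordered pairs of points at distance exactly $1$, then at least $c_6 n$ points of $P$ are typical (with respect to the constants $c_4,c_5,c_5'$).
   Context: For $p\in\mathbb{R}^2$, $C(p)$ denotes the circle of radius $1$ centered at $p$. For two points $q,r$ at distance less than $1$ from each other, $L(q,r)$ denotes the union of the two crescent-shaped regions (lunes) bounded by $C(q)$ and $C(r)$, i.e. the set of points $x\in\mathbb{R}^2$ such that either $|x-q|<1<|x-r|$ or $|x-r|<1<|x-q|$. For a set $P$ of $n$ points in the plane and positive constants $c_4,c_5,c_5'$, a point $p\in P$ is called typical if there are at least $c_4 n^{1/3}$ pairs of points $q,r\in P$ (at distance less than $1$) that are consecutive among the points of $P$ on the circle $C(p)$ and satisfy $$c_5 n^{2/3}\le |L(q,r)\cap P|\le c_5' n^{2/3}.$$ *)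

theory Defs
  imports "HOL-Analysis.Analysis"
begin

definition unit_circle :: "real ^ 2 \<Rightarrow> (real ^ 2) set" where
  "unit_circle p = sphere p 1"

definition circle_point :: "real ^ 2 \<Rightarrow> real \<Rightarrow> real ^ 2" where
  "circle_point p t = p + vector [cos t, sin t]"

text \<open>Meaningful as a pair of lunes only when \<^term>\<open>dist q r < 1\<close>.\<close>

definition lunes :: "real ^ 2 \<Rightarrow> real ^ 2 \<Rightarrow> (real ^ 2) set" where
  "lunes q r = {x. (dist x q < 1 \<and> 1 < dist x r) \<or> (dist x r < 1 \<and> 1 < dist x q)}"

text \<open>
  Going counterclockwise around the unit circle centred at \<open>p\<close>, the point \<open>r\<close> is the next
  point of \<open>P\<close> after \<open>q\<close>; the bound \<open>b < a + 2 * pi\<close> forces \<open>q \<noteq> r\<close>.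
\<close>

definition next_on_circle ::
  "(real ^ 2) set \<Rightarrow> real ^ 2 \<Rightarrow> real ^ 2 \<Rightarrow> real ^ 2 \<Rightarrow> bool" where
  "next_on_circle P p q r \<longleftrightarrow>
     q \<in> P \<inter> unit_circle p \<and> r \<in> P \<inter> unit_circle p \<and>
     (\<exists>a b. a < b \<and> b < a + 2 * pi \<and> q = circle_point p a \<and> r = circle_point p b \<and>
        (\<forall>t. a < t \<and> t < b \<longrightarrow> circle_point p t \<notin> P))"

definition consecutive_on_circle ::
  "(real ^ 2) set \<Rightarrow> real ^ 2 \<Rightarrow> real ^ 2 \<Rightarrow> real ^ 2 \<Rightarrow> bool" where
  "consecutive_on_circle P p q r \<longleftrightarrow> next_on_circle P p q r \<or> next_on_circle P p r q"

text \<open>Pairs of points are unordered here and below, and are counted as two-element sets.\<close>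

definition typical ::
  "real \<Rightarrow> real \<Rightarrow> real \<Rightarrow> (real ^ 2) set \<Rightarrow> real ^ 2 \<Rightarrow> bool" where
  "typical c4 c5 c5' P p \<longleftrightarrow> p \<in> P \<and>
     c4 * real (card P) powr (1/3) \<le>
       real (card {{q, r} | q r. consecutive_on_circle P p q r \<and> dist q r < 1 \<and>
         c5 * real (card P) powr (2/3) \<le> real (card (lunes q r \<inter> P)) \<and>
         real (card (lunes q r \<inter> P)) \<le> c5' * real (card P) powr (2/3)})"

definition unit_distance_pairs :: "(real ^ 2) set \<Rightarrow> (real ^ 2) set set" where
  "unit_distance_pairs P = {{x, y} | x y. x \<in> P \<and> y \<in> P \<and> dist x y = 1}"

end

theory Submission
  imports Defs
begin

text \<open>
  Draw an edge along the arc of \<open>C(p)\<close> between any two consecutive points \<open>q\<close>, \<open>r\<close> on it, and run the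
  crossing-lemma proof of the Szemeredi--Trotter bound with crossings localised to lunes. Cut every
  unit circle into twelve sectors. In suitable coordinates the arcs of one sector lie on upper caps
  of unit circles, so two of them meet at most once, and if an arc of \<open>C(x)\<close> crosses the arc
  \<open>qr\<close>, then \<open>C(x)\<close> separates \<open>q\<close> from \<open>r\<close>, that is \<open>x \<in> L(q,r)\<close>. A non-crossing family of such arcs
  has at most three times as many arcs as points, and sampling points with probability \<open>1/m\<close> gives
  \<open>|E| \<le> 3nm + (\<Sum>|L(q,r) \<inter> S|)/m\<^sup>2\<close> for any family \<open>E\<close> of arcs whose centres lie in \<open>S\<close>.

  With \<open>m\<close> of order \<open>n\<close> to the power \<open>1/3\<close> this leaves few arcs whose lunes contain too few points. Arcs
  whose lunes contain too many points are few because any two circles meet at most twice, whence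
  \<open>\<Sum>|L(q,r) \<inter> S| \<le> 2|S|\<^sup>2\<close>. The same two bounds, with \<open>S\<close> the set of typical points, show that a small
  set of typical points carries few arcs, while a non-typical point carries few good arcs by definition.
\<close>

section \<open>Non-crossing monotone drawings have linearly many edges\<close>

text \<open>Edges are graphs of functions over the interval between the abscissas of their
  endpoints. Non-crossing is expressed by order alone, which takes the place of continuity: a strict
  comparison at one common abscissa stays weakly valid at all others. Since \<open>meet_once\<close>
  applies at endpoints too, it excludes parallel edges.\<close>

locale monotone_drawing =
  fixes V :: "'v set" and X Y :: "'v \<Rightarrow> real"
    and E :: "'e set" and left right :: "'e \<Rightarrow> 'v" and h :: "'e \<Rightarrow> real \<Rightarrow> real"
  assumes finite_V: "finite V" and finite_E: "finite E"
    and inj_XY: "inj_on (\<lambda>v. (X v, Y v)) V"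
    and left_V: "e \<in> E \<Longrightarrow> left e \<in> V" and right_V: "e \<in> E \<Longrightarrow> right e \<in> V"
    and left_less_right: "e \<in> E \<Longrightarrow> X (left e) < X (right e)"
    and h_left: "e \<in> E \<Longrightarrow> h e (X (left e)) = Y (left e)"
    and h_right: "e \<in> E \<Longrightarrow> h e (X (right e)) = Y (right e)"
    and no_inner_vertex:
      "\<lbrakk>e \<in> E; v \<in> V; X (left e) < X v; X v < X (right e)\<rbrakk> \<Longrightarrow> h e (X v) \<noteq> Y v"
    and no_crossing:
      "\<lbrakk>e \<in> E; f \<in> E; X (left e) \<le> x; X (left f) \<le> x; x \<le> X (right e); x \<le> X (right f);
        X (left e) \<le> y; X (left f) \<le> y; y \<le> X (right e); y \<le> X (right f); h e x < h f x\<rbrakk>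
        \<Longrightarrow> h e y \<le> h f y"
    and meet_once:
      "\<lbrakk>e \<in> E; f \<in> E; e \<noteq> f; X (left e) \<le> x; X (left f) \<le> x; x < y; y \<le> X (right e); y \<le> X (right f);
        h e x = h f x\<rbrakk> \<Longrightarrow> h e y \<noteq> h f y"
    and no_inner_meet:
      "\<lbrakk>e \<in> E; f \<in> E; e \<noteq> f; X (left e) < x; X (left f) < x; x < X (right e); x < X (right f)\<rbrakk>
        \<Longrightarrow> h e x \<noteq> h f x"
begin

lemma vertex_eqI: "\<lbrakk>u \<in> V; v \<in> V; X u = X v; Y u = Y v\<rbrakk> \<Longrightarrow> u = v"
  using inj_XY by (auto simp: inj_on_def)

text \<open>The edges already meet at their common left endpoint, so \<open>meet_once\<close> rules
  out equality later and makes the weak order of \<open>no_crossing\<close> strict.\<close>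

lemma same_left_order:
  assumes "e \<in> E" "f \<in> E" "left e = left f"
    and x: "X (left e) < x" "x \<le> X (right e)" "x \<le> X (right f)"
    and y: "X (left e) < y" "y \<le> X (right e)" "y \<le> X (right f)"
    and less: "h e x < h f x"
  shows "h e y < h f y"
proof -
  have "e \<noteq> f" using less by auto
  have "h e y \<le> h f y" using no_crossing[of e f x y] assms by simp
  moreover have "h e y \<noteq> h f y"
    using meet_once[of e f "X (left e)" y] assms \<open>e \<noteq> f\<close> h_left[of e] h_left[of f] by simp
  ultimately show ?thesis by simp
qed

text \<open>All edges leaving \<open>v\<close> to the right are defined at this abscissa, so their heights there
  order them linearly.\<close>

definition reach :: "'v \<Rightarrow> real" where
  "reach v = Min ((\<lambda>f. X (right f)) ` {f \<in> E. left f = v})"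

definition over :: "'e \<Rightarrow> 'e set" where
  "over e = {f \<in> E. left f = left e \<and> h e (reach (left e)) < h f (reach (left e))}"

definition succ :: "'e \<Rightarrow> 'e" where
  "succ e = arg_min_on (\<lambda>f. h f (reach (left e))) (over e)"

text \<open>The closed region between \<open>e\<close> and the next edge above it from the same
  vertex, cut off where the first of them ends. For a topmost \<open>e\<close>,
  \<open>succ e\<close> is arbitrary and the wedge has no meaning.\<close>

definition wedge :: "'e \<Rightarrow> 'v set" where
  "wedge e = {w \<in> V. X (left e) < X w \<and> X w \<le> X (right e) \<and> X w \<le> X (right (succ e)) \<and>
     h e (X w) \<le> Y w \<and> Y w \<le> h (succ e) (X w)}"

lemma reach_bounds:
  assumes "e \<in> E"
  shows "X (left e) < reach (left e)" "reach (left e) \<le> X (right e)"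
proof -
  let ?A = "(\<lambda>f. X (right f)) ` {f \<in> E. left f = left e}"
  have fin: "finite ?A" and ne: "?A \<noteq> {}" using finite_E assms by auto
  have "Min ?A \<in> ?A" by (rule Min_in[OF fin ne])
  then show "X (left e) < reach (left e)" unfolding reach_def using left_less_right by fastforce
  show "reach (left e) \<le> X (right e)" unfolding reach_def by (rule Min_le[OF fin]) (use assms in auto)
qed

lemma succ:
  assumes "over e \<noteq> {}"
  shows "succ e \<in> over e" "f \<in> over e \<Longrightarrow> h (succ e) (reach (left e)) \<le> h f (reach (left e))"
proof -
  have fin: "finite (over e)" using finite_E by (simp add: over_def)
  show "succ e \<in> over e" unfolding succ_def by (rule arg_min_if_finite(1)[OF fin assms])
  show "h (succ e) (reach (left e)) \<le> h f (reach (left e))" if "f \<in> over e"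
    unfolding succ_def using arg_min_least[OF fin assms that] .
qed

context
  fixes e assumes e: "e \<in> E" and non_top: "over e \<noteq> {}"
begin

lemma succ_E: "succ e \<in> E" and left_succ: "left (succ e) = left e"
  using succ(1)[OF non_top] by (auto simp: over_def)

lemma succ_above:
  assumes "X (left e) < x" "x \<le> X (right e)" "x \<le> X (right (succ e))"
  shows "h e x < h (succ e) x"
  using same_left_order[OF e succ_E left_succ[symmetric], of "reach (left e)" x]
    reach_bounds[OF e] reach_bounds[OF succ_E] succ(1)[OF non_top] assms left_succ
  by (auto simp: over_def)

text \<open>Edges leaving one vertex keep their order, so the position of \<open>f\<close> at
  \<open>x\<close> carries over to \<open>reach (left e)\<close>, where \<open>succ e\<close> is the
  lowest edge above \<open>e\<close>.\<close>

lemma none_between_succ: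
  assumes f: "f \<in> E" "left f = left e"
    and x: "X (left e) < x" "x \<le> X (right e)" "x \<le> X (right (succ e))" "x \<le> X (right f)"
    and less: "h e x < h f x" "h f x < h (succ e) x"
  shows False
proof -
  have "h e (reach (left e)) < h f (reach (left e))"
    using same_left_order[of e f x "reach (left e)"] e f x less reach_bounds[OF e] reach_bounds[OF f(1)]
    by auto
  then have "f \<in> over e" using f by (simp add: over_def)
  moreover have "h f (reach (left e)) < h (succ e) (reach (left e))"
    using same_left_order[of f "succ e" x "reach (left e)"] succ_E left_succ f x less
      reach_bounds[OF succ_E] reach_bounds[OF f(1)]
    by auto
  ultimately show False using succ(2)[OF non_top] by force
qed

text \<open>The right endpoint of whichever edge ends first lies in the wedge, which is why the
  wedge includes its bounding edges.\<close>

lemma wedge_nonempty: "wedge e \<noteq> {}"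
proof (cases "X (right e) \<le> X (right (succ e))")
  case True
  then have "right e \<in> wedge e"
    using e right_V left_less_right h_right succ_above[of "X (right e)"] by (force simp: wedge_def)
  then show ?thesis by auto
next
  case False
  then have "right (succ e) \<in> wedge e"
    using e right_V[OF succ_E] left_less_right[OF succ_E] h_right[OF succ_E] left_succ
      succ_above[of "X (right (succ e))"]
    by (auto simp: wedge_def)
  then show ?thesis by auto
qed

end

text \<open>A non-topmost edge is charged to the leftmost vertex of its wedge. A vertex receives at most one
  charge from the edges ending in it and at most one from the edges passing below it.\<close>

definition charge :: "'e \<Rightarrow> 'v" where
  "charge e = (SOME w. w \<in> wedge e \<and>
     (\<forall>u\<in>wedge e. X w \<le> X u \<and> (X u = X w \<longrightarrow> Y w \<le> Y u)))"

lemma charge: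
  assumes "e \<in> E" "over e \<noteq> {}"
  shows "charge e \<in> wedge e"
    and "u \<in> wedge e \<Longrightarrow> X (charge e) \<le> X u"
    and "u \<in> wedge e \<Longrightarrow> X u = X (charge e) \<Longrightarrow> Y (charge e) \<le> Y u"
proof -
  have fin: "finite (wedge e)" using finite_V by (simp add: wedge_def)
  define m where "m = arg_min_on X (wedge e)"
  have m: "m \<in> wedge e" "\<And>u. u \<in> wedge e \<Longrightarrow> X m \<le> X u"
    unfolding m_def using arg_min_if_finite(1)[OF fin wedge_nonempty[OF assms]]
      arg_min_least[OF fin wedge_nonempty[OF assms]] by auto
  define B where "B = {w \<in> wedge e. X w = X m}"
  have B: "finite B" "B \<noteq> {}" using fin m by (auto simp: B_def)
  define w where "w = arg_min_on Y B"
  have w: "w \<in> B" "\<And>u. u \<in> B \<Longrightarrow> Y w \<le> Y u"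
    unfolding w_def using arg_min_if_finite(1)[OF B] arg_min_least[OF B] by auto
  have "\<exists>w. w \<in> wedge e \<and> (\<forall>u\<in>wedge e. X w \<le> X u \<and> (X u = X w \<longrightarrow> Y w \<le> Y u))"
    using w m(2) by (intro exI[of _ w]) (auto simp: B_def)
  from someI_ex[OF this, folded charge_def]
  show "charge e \<in> wedge e" "u \<in> wedge e \<Longrightarrow> X (charge e) \<le> X u"
    "u \<in> wedge e \<Longrightarrow> X u = X (charge e) \<Longrightarrow> Y (charge e) \<le> Y u" by auto
qed

lemma charge_V: "e \<in> E \<Longrightarrow> over e \<noteq> {} \<Longrightarrow> charge e \<in> V"
  using charge(1)[of e] by (auto simp: wedge_def)

text \<open>Key to both injectivity claims for charges. If \<open>f\<close> starts to the right of
  \<open>left e\<close>, its left endpoint is a vertex of the wedge before the leftmost one.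
  Otherwise \<open>f\<close> is squeezed through the vertex \<open>left e\<close>, hence starts
  there, and then lies strictly between \<open>e\<close> and \<open>succ e\<close>.\<close>

lemma no_edge_through_wedge:
  assumes e: "e \<in> E" "over e \<noteq> {}" and f: "f \<in> E"
    and w: "X (left f) < X (charge e)" "X (charge e) \<le> X (right f)"
      "h f (X (charge e)) < h (succ e) (X (charge e))"
    and x: "X (left e) \<le> x" "X (left f) \<le> x" "x \<le> X (right e)" "x \<le> X (right f)" "h e x < h f x"
  shows False
proof -
  let ?w = "charge e" and ?s = "succ e"
  note s = succ_E[OF e] left_succ[OF e]
  have we: "X (left e) < X ?w" "X ?w \<le> X (right e)" "X ?w \<le> X (right ?s)"
    using charge(1)[OF e] by (auto simp: wedge_def)
  show False
  proof (cases "X (left e) < X (left f)")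
    case True
    have "h e (X (left f)) \<le> h f (X (left f))"
      using no_crossing[of e f x "X (left f)"] e f x w we True by auto
    moreover have "h f (X (left f)) \<le> h ?s (X (left f))"
      using no_crossing[of f ?s "X ?w" "X (left f)"] f s w we True by auto
    ultimately have "left f \<in> wedge e"
      using True w we left_V[OF f] h_left[OF f] by (auto simp: wedge_def)
    then show False using charge(2)[OF e] w by force
  next
    case False
    have le1: "Y (left e) \<le> h f (X (left e))"
      using no_crossing[of e f x "X (left e)"] e f x w we False h_left[of e] by auto
    have le2: "h f (X (left e)) \<le> Y (left e)"
      using no_crossing[of f ?s "X ?w" "X (left e)"] f s w we False h_left[of ?s] by auto
    have eq: "h f (X (left e)) = Y (left e)" using le1 le2 by simp
    have xe: "X (left f) = X (left e)"
      using no_inner_vertex[OF f left_V[OF e(1)]] eq False w we by force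
    have "Y (left f) = Y (left e)" using eq h_left[OF f] unfolding xe by (rule trans[OF sym, rotated])
    then have lf: "left f = left e" by (rule vertex_eqI[OF left_V[OF f] left_V[OF e(1)] xe])
    have "x \<noteq> X (left e)"
    proof
      assume "x = X (left e)"
      then have "h e (X (left e)) < h f (X (left e))" using x(5) by simp
      then show False unfolding eq h_left[OF e(1)] by simp
    qed
    then have "h e (X ?w) < h f (X ?w)"
      by (intro same_left_order[OF e(1) f lf[symmetric] _ x(3,4) we(1,2) w(2) x(5)]) (use x(1) in simp)
    then show False using none_between_succ[OF e f lf we w(2) _ w(3)] by simp
  qed
qed

lemma charge_strictly_above:
  assumes e: "e \<in> E" "over e \<noteq> {}" and ne: "charge e \<noteq> right e"
  shows "X (charge e) < X (right e)" "h e (X (charge e)) < Y (charge e)"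
proof -
  have w: "charge e \<in> V" "X (left e) < X (charge e)" "X (charge e) \<le> X (right e)"
    "X (charge e) \<le> X (right (succ e))" "h e (X (charge e)) \<le> Y (charge e)"
    using charge(1)[OF e] by (auto simp: wedge_def)
  \<comment> \<open>At the abscissa of \<open>right e\<close> the wedge has no vertex below
    \<open>right e\<close>, so charging the lowest of the leftmost vertices would select
    \<open>right e\<close> itself.\<close>
  show less: "X (charge e) < X (right e)"
  proof (rule ccontr)
    assume "\<not> ?thesis"
    then have eq: "X (charge e) = X (right e)" using w by simp
    then have "right e \<in> wedge e"
      using w right_V[OF e(1)] h_right[OF e(1)] succ_above[OF e, of "X (right e)"]
      by (auto simp: wedge_def)
    then have "Y (charge e) \<le> Y (right e)" using charge(3)[OF e] eq by simp
    then have "charge e = right e"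
      using vertex_eqI[OF w(1) right_V[OF e(1)] eq] w(5) h_right[OF e(1)] eq by simp
    with ne show False by simp
  qed
  show "h e (X (charge e)) < Y (charge e)" using no_inner_vertex[OF e(1) w(1,2) less] w(5) by simp
qed

text \<open>Two topmost edges from one vertex would have equal height at \<open>reach\<close>, hence
  meet twice.\<close>

lemma inj_on_top: "inj_on left {e \<in> E. over e = {}}"
proof (rule inj_onI)
  fix e f assume e: "e \<in> {e \<in> E. over e = {}}" and f: "f \<in> {e \<in> E. over e = {}}" and lf: "left e = left f"
  then have "h e (reach (left e)) = h f (reach (left e))"
    by (auto simp: over_def) (metis (mono_tags, lifting) linorder_neqE_linordered_idom)
  then show "e = f"
    using meet_once[of e f "X (left e)" "reach (left e)"] e f lf reach_bounds[of e] reach_bounds[of f]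
      h_left[of e] h_left[of f] by auto
qed

text \<open>Of two edges charged at a common right end, the upper one would approach that vertex
  inside the wedge of the lower one.\<close>

lemma inj_on_charge_right: "inj_on charge {e \<in> E. over e \<noteq> {} \<and> charge e = right e}"
proof (rule inj_onI, rule ccontr)
  fix e f assume e: "e \<in> {e \<in> E. over e \<noteq> {} \<and> charge e = right e}"
    and f: "f \<in> {e \<in> E. over e \<noteq> {} \<and> charge e = right e}"
    and eq: "charge e = charge f" and ne: "e \<noteq> f"
  have E: "e \<in> E" "f \<in> E" and r: "right e = right f" using e f eq by auto
  define x where "x = (max (X (left e)) (X (left f)) + X (right e)) / 2"
  have x: "X (left e) < x" "X (left f) < x" "x < X (right e)" "x < X (right f)"
    using left_less_right[OF E(1)] left_less_right[OF E(2)] r by (auto simp: x_def max_def)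
  have *: False if "e \<in> {e \<in> E. over e \<noteq> {} \<and> charge e = right e}" "f \<in> E" "right f = right e"
    "X (left e) < x" "X (left f) < x" "x < X (right e)" "h e x < h f x" for e f
  proof -
    have "h e (X (right e)) < h (succ e) (X (right e))"
      using that charge(1)[of e] left_less_right[of e] by (intro succ_above) (auto simp: wedge_def)
    then show False
      using that h_right[of e] h_right[of f] left_less_right[of f]
      by (intro no_edge_through_wedge[of e f x]) simp_all
  qed
  from no_inner_meet[OF E ne x] consider "h e x < h f x" | "h f x < h e x" by linarith
  then show False
  proof cases
    case 1
    show False by (rule *[OF e E(2) r[symmetric] x(1-3) 1])
  next
    case 2
    show False by (rule *[OF f E(1) r x(2,1,4) 2])
  qed
qed

text \<open>Both edges pass strictly below the charged vertex, which is at or below both successors;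
  so the upper edge would run through the wedge of the lower one.\<close>

lemma inj_on_charge_inner: "inj_on charge {e \<in> E. over e \<noteq> {} \<and> charge e \<noteq> right e}"
proof (rule inj_onI, rule ccontr)
  fix e f assume e: "e \<in> {e \<in> E. over e \<noteq> {} \<and> charge e \<noteq> right e}"
    and f: "f \<in> {e \<in> E. over e \<noteq> {} \<and> charge e \<noteq> right e}"
    and eq: "charge e = charge f" and ne: "e \<noteq> f"
  let ?x = "X (charge e)"
  have E: "e \<in> E" "f \<in> E" "over e \<noteq> {}" "over f \<noteq> {}" using e f by auto
  have w: "X (left e) < ?x" "X (left f) < ?x" "?x < X (right e)" "?x < X (right f)"
    "h e ?x < Y (charge e)" "h f ?x < Y (charge e)"
    "Y (charge e) \<le> h (succ e) ?x" "Y (charge e) \<le> h (succ f) ?x"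
    using charge(1)[of e] charge(1)[of f] E eq charge_strictly_above[of e] charge_strictly_above[of f] e f
    by (auto simp: wedge_def)
  from no_inner_meet[OF E(1,2) ne w(1-4)] consider "h e ?x < h f ?x" | "h f ?x < h e ?x" by linarith
  then show False
  proof cases
    case 1
    then show False using w by (intro no_edge_through_wedge[OF E(1,3,2), of ?x]) simp_all
  next
    case 2
    then show False using w eq by (intro no_edge_through_wedge[OF E(2,4,1), of ?x]) simp_all
  qed
qed

theorem card_edges_le: "card E \<le> 3 * card V"
proof -
  let ?A = "{e \<in> E. over e = {}}" and ?B = "{e \<in> E. over e \<noteq> {} \<and> charge e = right e}"
    and ?C = "{e \<in> E. over e \<noteq> {} \<and> charge e \<noteq> right e}"
  have "card ?A \<le> card V" using left_V by (intro card_inj_on_le[OF inj_on_top _ finite_V]) auto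
  moreover have "card ?B \<le> card V"
    using charge_V by (intro card_inj_on_le[OF inj_on_charge_right _ finite_V]) blast
  moreover have "card ?C \<le> card V"
    using charge_V by (intro card_inj_on_le[OF inj_on_charge_inner _ finite_V]) blast
  moreover have "E = ?A \<union> ?B \<union> ?C" by auto
  then have "card E \<le> card ?A + card ?B + card ?C"
    by (metis (no_types, lifting) card_Un_le add_le_mono1 order_trans)
  ultimately show ?thesis by linarith
qed

end

section \<open>Upper caps of unit circles and random sampling\<close>

text \<open>The upper half of the unit circle centred at \<open>(a, b)\<close>. Since
  \<open>sqrt\<close> is odd and increasing on all reals, \<open>cap_le\<close>,
  \<open>above_cap_outside\<close> and \<open>below_cap_inside\<close> hold for every
  \<open>x\<close>.\<close>

definition cap :: "real \<Rightarrow> real \<Rightarrow> real \<Rightarrow> real" where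
  "cap a b x = b + sqrt (1 - (x - a)\<^sup>2)"

lemma continuous_on_cap [continuous_intros]: "continuous_on A (cap a b)"
  unfolding cap_def by (intro continuous_intros)

lemma cap_le: "cap a b x \<le> b + 1"
  by (simp add: cap_def)

lemma cap_ge: "\<bar>x - a\<bar> \<le> 3/10 \<Longrightarrow> b + 9/10 \<le> cap a b x"
proof -
  assume "\<bar>x - a\<bar> \<le> 3/10"
  then have "(x - a)\<^sup>2 \<le> (3/10)\<^sup>2" by (rule power2_le_iff_abs_le[THEN iffD2, rotated]) simp
  then have "9/10 \<le> sqrt (1 - (x - a)\<^sup>2)" by (intro real_le_rsqrt) (simp add: power2_eq_square)
  then show ?thesis by (simp add: cap_def)
qed

lemma cap_on_circle: "\<bar>x - a\<bar> \<le> 1 \<Longrightarrow> (x - a)\<^sup>2 + (cap a b x - b)\<^sup>2 = 1"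
  using abs_square_le_1[of "x - a"] by (simp add: cap_def)

lemma above_cap_outside: "b \<le> y \<Longrightarrow> cap a b x < y \<Longrightarrow> 1 < (x - a)\<^sup>2 + (y - b)\<^sup>2"
proof -
  assume y: "b \<le> y" "cap a b x < y"
  then have "sqrt (1 - (x - a)\<^sup>2) < sqrt ((y - b)\<^sup>2)" by (simp add: cap_def)
  then show ?thesis by (simp only: real_sqrt_less_iff)
qed

lemma below_cap_inside: "b \<le> y \<Longrightarrow> y < cap a b x \<Longrightarrow> (x - a)\<^sup>2 + (y - b)\<^sup>2 < 1"
proof -
  assume y: "b \<le> y" "y < cap a b x"
  then have "sqrt ((y - b)\<^sup>2) < sqrt (1 - (x - a)\<^sup>2)" by (simp add: cap_def)
  then show ?thesis by (simp only: real_sqrt_less_iff)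
qed

text \<open>The quotient is \<open>tan (arcsin u)\<close>; up to sign it is the slope of a cap at
  horizontal offset \<open>u\<close> from its centre.\<close>

lemma slope_strict_mono:
  fixes u w :: real
  assumes "-1 < u" "u < w" "w < 1"
  shows "u / sqrt (1 - u\<^sup>2) < w / sqrt (1 - w\<^sup>2)"
proof -
  have "tan (arcsin u) < tan (arcsin w)"
    using assms arcsin_lt_bounded[of u] arcsin_lt_bounded[of w] arcsin_less_arcsin[of u w]
    by (intro tan_monotone) auto
  then show ?thesis using assms by (simp add: tan_def cos_arcsin)
qed

text \<open>This makes the caps a family of pseudo-lines: two distinct ones meet at most once.\<close>

lemma cap_diff_strict_antimono:
  assumes ac: "a < c" and xy: "x < y" and "\<bar>x - a\<bar> < 1" "\<bar>y - a\<bar> < 1" "\<bar>x - c\<bar> < 1" "\<bar>y - c\<bar> < 1"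
  shows "cap a b y - cap c d y < cap a b x - cap c d x"
proof (rule DERIV_neg_imp_decreasing[OF xy, where f = "\<lambda>t. cap a b t - cap c d t"], intro exI conjI)
  fix t assume t: "x \<le> t" "t \<le> y"
  have pos: "0 < 1 - (t - a)\<^sup>2" "0 < 1 - (t - c)\<^sup>2"
    using assms t by (auto simp: abs_square_less_1)
  show "((\<lambda>t. cap a b t - cap c d t) has_real_derivative
      (t - c) / sqrt (1 - (t - c)\<^sup>2) - (t - a) / sqrt (1 - (t - a)\<^sup>2)) (at t)"
    unfolding cap_def using pos by (auto intro!: derivative_eq_intros simp: field_simps)
  show "(t - c) / sqrt (1 - (t - c)\<^sup>2) - (t - a) / sqrt (1 - (t - a)\<^sup>2) < 0"
    using slope_strict_mono[of "t - c" "t - a"] assms t by auto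
qed

text \<open>Subtracting the equations fixes the inner product of a common point with the difference
  of the centres. The perpendicular component \<open>s\<close> then has a prescribed square, hence
  at most two values, and both components together determine the point.\<close>

lemma two_unit_circles:
  fixes a b c d :: real
  assumes "(a, b) \<noteq> (c, d)"
  defines "I \<equiv> {(x, y). (x - a)\<^sup>2 + (y - b)\<^sup>2 = 1 \<and> (x - c)\<^sup>2 + (y - d)\<^sup>2 = 1}"
  shows "finite I" "card I \<le> 2"
proof -
  define u v where "u = c - a" and "v = d - b"
  define N where "N = u\<^sup>2 + v\<^sup>2"
  have N: "N > 0" using assms(1) by (auto simp: N_def u_def v_def sum_power2_gt_zero_iff)
  define s where "s = (\<lambda>(x, y). (x - a) * v - (y - b) * u)"
  define \<sigma> where "\<sigma> = sqrt (N - N\<^sup>2 / 4)"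
  have inner: "(x - a) * u + (y - b) * v = N / 2" if "(x, y) \<in> I" for x y
    using that unfolding I_def N_def u_def v_def by (auto simp: power2_eq_square algebra_simps)
  have "inj_on s I"
  proof (rule inj_onI, clarify)
    fix x y x' y' assume I: "(x, y) \<in> I" "(x', y') \<in> I" and s: "s (x, y) = s (x', y')"
    have 1: "(x - x') * u + (y - y') * v = 0" using inner[OF I(1)] inner[OF I(2)] by (simp add: algebra_simps)
    have 2: "(x - x') * v - (y - y') * u = 0" using s by (simp add: s_def algebra_simps)
    have "(x - x') * N = ((x - x') * u + (y - y') * v) * u + ((x - x') * v - (y - y') * u) * v"
      "(y - y') * N = ((x - x') * u + (y - y') * v) * v - ((x - x') * v - (y - y') * u) * u"
      by (simp_all add: N_def power2_eq_square algebra_simps)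
    then show "x = x' \<and> y = y'" unfolding 1 2 using N by simp
  qed
  moreover have "s ` I \<subseteq> {\<sigma>, - \<sigma>}"
  proof (rule image_subsetI)
    fix z assume "z \<in> I"
    then obtain x y where z: "z = (x, y)" and I: "(x, y) \<in> I" by (cases z) auto
    have "(s (x, y))\<^sup>2 + ((x - a) * u + (y - b) * v)\<^sup>2 = ((x - a)\<^sup>2 + (y - b)\<^sup>2) * N"
      by (simp add: s_def N_def power2_eq_square algebra_simps)
    also have "\<dots> = N" using I by (simp add: I_def)
    finally have *: "(s (x, y))\<^sup>2 = N - N\<^sup>2 / 4" using inner[OF I] by (simp add: power2_eq_square)
    then have "0 \<le> N - N\<^sup>2 / 4" by (metis zero_le_power2)
    then have "(s (x, y))\<^sup>2 = \<sigma>\<^sup>2" using * by (simp add: \<sigma>_def)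
    then show "s z \<in> {\<sigma>, - \<sigma>}" unfolding z by (simp add: power2_eq_iff)
  qed
  ultimately show "finite I" "card I \<le> 2"
    using inj_on_finite[of s I "{\<sigma>, - \<sigma>}"] card_inj_on_le[of s I "{\<sigma>, - \<sigma>}"]
      card_insert_le_m1[of 2 "{- \<sigma>}" \<sigma>] by auto
qed

section \<open>Random samples by counting colourings\<close>

text \<open>Divided by the number \<open>m ^ card P\<close> of all colourings: a random colouring
  gives all of \<open>T\<close> the colour 0 with probability \<open>1 / m ^ card T\<close>.\<close>

lemma card_colourings_zero_on:
  assumes "finite P" "T \<subseteq> P" "m > 0"
  shows "real (card {g \<in> P \<rightarrow>\<^sub>E {..<m}. \<forall>x\<in>T. g x = 0}) = real m ^ card P / real m ^ card T"
proof -
  have "{g \<in> P \<rightarrow>\<^sub>E {..<m}. \<forall>x\<in>T. g x = 0} = (\<Pi>\<^sub>E x\<in>P. if x \<in> T then {0} else {..<m})"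
  proof (intro set_eqI iffI)
    fix g assume "g \<in> {g \<in> P \<rightarrow>\<^sub>E {..<m}. \<forall>x\<in>T. g x = 0}"
    then show "g \<in> (\<Pi>\<^sub>E x\<in>P. if x \<in> T then {0} else {..<m})" by (auto simp: PiE_iff)
  next
    fix g assume g: "g \<in> (\<Pi>\<^sub>E x\<in>P. if x \<in> T then {0} else {..<m})"
    have "g x < m" if "x \<in> P" for x
      using PiE_mem[OF g that] assms(3) by (auto split: if_splits)
    moreover have "g x = 0" if "x \<in> T" for x
      using PiE_mem[OF g, of x] assms(2) that by auto
    ultimately show "g \<in> {g \<in> P \<rightarrow>\<^sub>E {..<m}. \<forall>x\<in>T. g x = 0}"
      using PiE_arb[OF g] by (auto simp: PiE_iff extensional_def)
  qed
  then have "card {g \<in> P \<rightarrow>\<^sub>E {..<m}. \<forall>x\<in>T. g x = 0} = (\<Prod>x\<in>P. if x \<in> T then 1 else m)"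
    using assms(1) by (simp add: card_PiE if_distrib cong: if_cong)
  also have "\<dots> = (\<Prod>x\<in>P - T. m)"
    using assms(1,2) by (intro prod.mono_neutral_cong_right) auto
  also have "\<dots> = m ^ (card P - card T)"
    using assms(1,2) by (simp add: card_Diff_subset finite_subset)
  finally show ?thesis
    using assms(3) card_mono[OF assms(1,2)] by (simp only: of_nat_power) (intro power_diff, simp_all)
qed

text \<open>Linearity of expectation, by swapping the sums over colourings and over
  \<open>I\<close>.\<close>

lemma sum_card_sampled:
  assumes P: "finite P" and I: "finite I" and m: "m > 0"
    and D: "\<And>i. i \<in> I \<Longrightarrow> D i \<subseteq> P \<and> card (D i) = k"
  shows "(\<Sum>g\<in>P \<rightarrow>\<^sub>E {..<m}. real (card {i \<in> I. D i \<subseteq> {x \<in> P. g x = 0}})) =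
    real (card I) * (real m ^ card P / real m ^ k)"
proof -
  let ?C = "P \<rightarrow>\<^sub>E {..<m}" and ?V = "\<lambda>g. {x \<in> P. g x = (0::nat)}"
  have finC: "finite ?C" using P by (auto intro!: finite_PiE)
  have "(\<Sum>g\<in>?C. real (card {i \<in> I. D i \<subseteq> ?V g})) = (\<Sum>g\<in>?C. \<Sum>i\<in>I. if D i \<subseteq> ?V g then 1 else 0)"
    using I by (intro sum.cong) (auto simp: sum.If_cases Int_def)
  also have "\<dots> = (\<Sum>i\<in>I. \<Sum>g\<in>?C. if D i \<subseteq> ?V g then 1 else 0)" by (rule sum.swap)
  also have "\<dots> = (\<Sum>i\<in>I. real m ^ card P / real m ^ k)"
  proof (rule sum.cong[OF refl])
    fix i assume i: "i \<in> I"
    have "(\<Sum>g\<in>?C. if D i \<subseteq> ?V g then 1 else 0) = real (card {g \<in> ?C. D i \<subseteq> ?V g})"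
      using finC by (simp add: sum.If_cases Int_def)
    also have "{g \<in> ?C. D i \<subseteq> ?V g} = {g \<in> ?C. \<forall>x\<in>D i. g x = 0}"
      using D[OF i] by auto
    finally show "(\<Sum>g\<in>?C. if D i \<subseteq> ?V g then 1 else 0) = real m ^ card P / real m ^ k"
      using card_colourings_zero_on[OF P _ m, of "D i"] D[OF i] by simp
  qed
  finally show ?thesis by simp
qed

text \<open>The sample is the set of points of colour 0, averaged over all colourings of \<open>P\<close>
  with \<open>m\<close> colours.\<close>

lemma random_sample_amplification:
  fixes A :: "'e \<Rightarrow> 'a set" and B :: "'f \<Rightarrow> 'a set"
  assumes P: "finite P" and E: "finite E" and F: "finite F" and m: "m > (0::nat)"
    and A: "\<And>e. e \<in> E \<Longrightarrow> A e \<subseteq> P \<and> card (A e) = 2"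
    and B: "\<And>f. f \<in> F \<Longrightarrow> B f \<subseteq> P \<and> card (B f) = 4"
    and sample: "\<And>V. V \<subseteq> P \<Longrightarrow>
      real (card {e \<in> E. A e \<subseteq> V}) \<le> 3 * real (card V) + real (card {f \<in> F. B f \<subseteq> V})"
  shows "real (card E) \<le> 3 * real (card P) * real m + real (card F) / real m ^ 2"
proof -
  define C where "C = P \<rightarrow>\<^sub>E {..<m}"
  define M where "M = real m ^ card P"
  have M: "M > 0" using m by (simp add: M_def)
  define V where "V = (\<lambda>g. {x \<in> P. g x = (0::nat)})"
  have double_count_E: "(\<Sum>g\<in>C. real (card {i \<in> E. A i \<subseteq> V g})) = real (card E) * (M / real m ^ 2)"
    unfolding C_def V_def M_def by (rule sum_card_sampled[OF P E m A])
  have double_count_F: "(\<Sum>g\<in>C. real (card {i \<in> F. B i \<subseteq> V g})) = real (card F) * (M / real m ^ 4)"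
    unfolding C_def V_def M_def by (rule sum_card_sampled[OF P F m B])
  have double_count_P: "(\<Sum>g\<in>C. real (card {x \<in> P. {x} \<subseteq> V g})) = real (card P) * (M / real m ^ 1)"
    unfolding C_def V_def M_def by (rule sum_card_sampled[OF P P m]) auto
  have card_V: "card (V g) = card {x \<in> P. {x} \<subseteq> V g}" for g
    by (rule arg_cong[where f = card]) (auto simp: V_def)
  have "(\<Sum>g\<in>C. real (card {e \<in> E. A e \<subseteq> V g}))
      \<le> (\<Sum>g\<in>C. 3 * real (card (V g)) + real (card {f \<in> F. B f \<subseteq> V g}))"
    by (intro sum_mono sample) (auto simp: V_def)
  also have "\<dots> = 3 * (\<Sum>g\<in>C. real (card {x \<in> P. {x} \<subseteq> V g})) + (\<Sum>g\<in>C. real (card {f \<in> F. B f \<subseteq> V g}))"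
    by (simp add: sum.distrib sum_distrib_left card_V)
  \<comment> \<open>Each point that must be sampled contributes a factor \<open>1 / m\<close>,
    whence the exponents 2, 1 and 4. Cancelling \<open>M / m ^ 2\<close> gives the claim.\<close>
  finally have "real (card E) * (M / real m ^ 2)
      \<le> 3 * (real (card P) * (M / real m ^ 1)) + real (card F) * (M / real m ^ 4)"
    unfolding double_count_E double_count_F double_count_P .
  then have "M / real m ^ 2 * real (card E)
      \<le> M / real m ^ 2 * (3 * real (card P) * real m + real (card F) / real m ^ 2)"
    using m by (simp add: field_simps eval_nat_numeral)
  then show ?thesis using M m by (subst (asm) mult_le_cancel_left_pos) auto
qed

section \<open>Arcs on upper caps\<close>

text \<open>A triple holds the centre, the left and the right endpoint of an arc. The bound 3/10
  keeps arcs within 1/10 of the top of their circle, and three such offsets still add up to less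
  than 1, so the endpoints of an arc stay in the horizontal range of every circle whose arc crosses
  it.\<close>

locale upper_arcs =
  fixes P :: "'a set" and X Y :: "'a \<Rightarrow> real" and E :: "('a \<times> 'a \<times> 'a) set"
  assumes finite_P: "finite P"
    and inj_XY: "inj_on (\<lambda>z. (X z, Y z)) P"
    and arc_points: "(p, q, r) \<in> E \<Longrightarrow> p \<in> P \<and> q \<in> P \<and> r \<in> P \<and> X q < X r"
    and arc_width: "(p, q, r) \<in> E \<Longrightarrow> \<bar>X q - X p\<bar> \<le> 3/10 \<and> \<bar>X r - X p\<bar> \<le> 3/10"
    and arc_cap: "(p, q, r) \<in> E \<Longrightarrow> Y q = cap (X p) (Y p) (X q) \<and> Y r = cap (X p) (Y p) (X r)"
    and arc_empty: "\<lbrakk>(p, q, r) \<in> E; z \<in> P; X q < X z; X z < X r\<rbrakk> \<Longrightarrow> Y z \<noteq> cap (X p) (Y p) (X z)"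
begin

definition dsq :: "'a \<Rightarrow> 'a \<Rightarrow> real" where
  "dsq x y = (X y - X x)\<^sup>2 + (Y y - Y x)\<^sup>2"

text \<open>Coordinate form of membership of \<open>x\<close> in \<open>lunes q r\<close>; see
  \<open>separates_iff_lunes\<close>.\<close>

definition separates :: "'a \<Rightarrow> 'a \<Rightarrow> 'a \<Rightarrow> bool" where
  "separates x q r \<longleftrightarrow> dsq x q < 1 \<and> 1 < dsq x r \<or> dsq x r < 1 \<and> 1 < dsq x q"

definition height :: "'a \<times> 'a \<times> 'a \<Rightarrow> real \<Rightarrow> real" where
  "height e = cap (X (fst e)) (Y (fst e))"

abbreviation lft :: "'a \<times> 'a \<times> 'a \<Rightarrow> 'a" where "lft e \<equiv> fst (snd e)"
abbreviation rgt :: "'a \<times> 'a \<times> 'a \<Rightarrow> 'a" where "rgt e \<equiv> snd (snd e)"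

text \<open>Pairs are ordered: the first arc is above on the left and below on the right, so by
  \<open>crossing_centres\<close> only one order of two arcs can occur. The strict inequalities keep
  a mere common endpoint from counting.\<close>

definition crossings :: "(('a \<times> 'a \<times> 'a) \<times> ('a \<times> 'a \<times> 'a)) set" where
  "crossings = {(e, f). e \<in> E \<and> f \<in> E \<and> (\<exists>x y. x < y \<and> X (lft e) \<le> x \<and> X (lft f) \<le> x \<and>
     y \<le> X (rgt e) \<and> y \<le> X (rgt f) \<and> height f x < height e x \<and> height e y < height f y)}"

lemma point_eqI: "\<lbrakk>u \<in> P; v \<in> P; X u = X v; Y u = Y v\<rbrakk> \<Longrightarrow> u = v"
  using inj_XY by (auto simp: inj_on_def)

lemma finite_E: "finite E"
  by (rule finite_subset[of _ "P \<times> P \<times> P"]) (use arc_points finite_P in auto)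

lemma arc_facts:
  assumes "e \<in> E"
  shows "fst e \<in> P" "lft e \<in> P" "rgt e \<in> P" "X (lft e) < X (rgt e)"
    "height e (X (lft e)) = Y (lft e)" "height e (X (rgt e)) = Y (rgt e)"
  using assms arc_points[of "fst e" "lft e" "rgt e"] arc_cap[of "fst e" "lft e" "rgt e"]
  by (auto simp: height_def)

lemma arc_near_centre:
  assumes "e \<in> E" "X (lft e) \<le> x" "x \<le> X (rgt e)"
  shows "\<bar>x - X (fst e)\<bar> \<le> 3/10"
proof -
  have "\<bar>X (lft e) - X (fst e)\<bar> \<le> 3/10 \<and> \<bar>X (rgt e) - X (fst e)\<bar> \<le> 3/10"
    using assms(1) by (intro arc_width) simp
  then show ?thesis using assms(2,3) by linarith
qed

lemma arc_inner_empty: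
  assumes "e \<in> E" "z \<in> P" "X (lft e) < X z" "X z < X (rgt e)"
  shows "height e (X z) \<noteq> Y z"
  using assms arc_empty[of "fst e" "lft e" "rgt e" z] by (auto simp: height_def)

text \<open>If two arcs of one circle overlapped, an endpoint of one would be a point of
  \<open>P\<close> inside the other, unless the arcs have both ends in common.\<close>

lemma same_circle_disjoint:
  assumes e: "e \<in> E" and f: "f \<in> E" and p: "fst e = fst f" and ne: "e \<noteq> f"
  shows "X (rgt e) \<le> X (lft f) \<or> X (rgt f) \<le> X (lft e)"
proof (rule ccontr)
  assume *: "\<not> ?thesis"
  have h: "height e = height f" using p by (simp add: height_def)
  note F = arc_facts[OF e] arc_facts[OF f]
  have "X (lft e) = X (lft f)"
    using arc_inner_empty[OF e F(8)] arc_inner_empty[OF f F(2)] h F * by (metis not_less_iff_gr_or_eq not_le)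
  then have l: "lft e = lft f" using point_eqI[OF F(2,8)] F(5,11) h by metis
  have "X (rgt e) = X (rgt f)"
    using arc_inner_empty[OF e F(9)] arc_inner_empty[OF f F(3)] h F * by (metis not_less_iff_gr_or_eq not_le)
  then have r: "rgt e = rgt f" using point_eqI[OF F(3,9)] F(6,12) h by metis
  show False using ne p l r by (auto simp: prod_eq_iff)
qed

lemma height_diff_antimono:
  assumes e: "e \<in> E" and f: "f \<in> E" and less: "X (fst e) < X (fst f)" and xy: "x < y"
    and "\<bar>x - X (fst e)\<bar> < 1" "\<bar>x - X (fst f)\<bar> < 1" "\<bar>y - X (fst e)\<bar> < 1" "\<bar>y - X (fst f)\<bar> < 1"
  shows "height e y - height f y < height e x - height f x"
  unfolding height_def using assms by (intro cap_diff_strict_antimono) auto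

lemma crossings_E: "(e, f) \<in> crossings \<Longrightarrow> e \<in> E" "(e, f) \<in> crossings \<Longrightarrow> f \<in> E"
  unfolding crossings_def by blast+

lemma crossingsI:
  assumes "e \<in> E" "f \<in> E" "x < y" "X (lft e) \<le> x" "X (lft f) \<le> x"
    "y \<le> X (rgt e)" "y \<le> X (rgt f)" "height f x < height e x" "height e y < height f y"
  shows "(e, f) \<in> crossings"
  unfolding crossings_def using assms by blast

text \<open>The difference of two caps is strictly monotone in a direction fixed by the order of the
  centres, and constant if their abscissas agree; a change from positive to negative leaves one
  case.\<close>

lemma crossing_centres:
  assumes ef: "(e, f) \<in> crossings"
  shows "X (fst e) < X (fst f)"
proof (rule ccontr)
  assume nl: "\<not> ?thesis"
  obtain x y where e: "e \<in> E" and f: "f \<in> E" and xy: "x < y" "X (lft e) \<le> x" "X (lft f) \<le> x"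
     "y \<le> X (rgt e)" "y \<le> X (rgt f)" "height f x < height e x" "height e y < height f y"
    using ef unfolding crossings_def by blast
  note near = arc_near_centre[OF e, of x] arc_near_centre[OF e, of y]
    arc_near_centre[OF f, of x] arc_near_centre[OF f, of y]
  show False
  proof (cases "X (fst e) = X (fst f)")
    case True
    then show False using xy by (auto simp: height_def cap_def)
  next
    case False
    then show False using height_diff_antimono[OF f e _ xy(1)] nl near xy by force
  qed
qed

text \<open>Monotonicity carries the sign change from the common interval out to the endpoints of
  \<open>e\<close>. They are compared with the full cap of \<open>f\<close>, since they may lie
  beyond its arc.\<close>

lemma crossing_heights:
  assumes ef: "(e, f) \<in> crossings"
  shows "Y (lft e) > height f (X (lft e))" "Y (rgt e) < height f (X (rgt e))"
    "Y (lft e) \<ge> Y (fst f)" "Y (rgt e) \<ge> Y (fst f)"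
proof -
  obtain x y where e: "e \<in> E" and f: "f \<in> E" and xy: "x < y" "X (lft e) \<le> x" "X (lft f) \<le> x"
     "y \<le> X (rgt e)" "y \<le> X (rgt f)" "height f x < height e x" "height e y < height f y"
    using ef unfolding crossings_def by blast
  note F = arc_facts[OF e] arc_facts[OF f]
  have near: "\<bar>x - X (fst e)\<bar> \<le> 3/10" "\<bar>y - X (fst e)\<bar> \<le> 3/10" "\<bar>x - X (fst f)\<bar> \<le> 3/10"
    "\<bar>y - X (fst f)\<bar> \<le> 3/10" "\<bar>X (lft e) - X (fst e)\<bar> \<le> 3/10" "\<bar>X (rgt e) - X (fst e)\<bar> \<le> 3/10"
    using xy F by (intro arc_near_centre[OF e] arc_near_centre[OF f]; linarith)+
  \<comment> \<open>From an endpoint of \<open>e\<close> via the centre of \<open>e\<close> and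
    \<open>x\<close> to the centre of \<open>f\<close> there are three steps of at most
    3/10.\<close>
  have near': "\<bar>X (lft e) - X (fst f)\<bar> < 1" "\<bar>X (rgt e) - X (fst f)\<bar> < 1"
    using near by linarith+
  have left: "height e x - height f x \<le> height e (X (lft e)) - height f (X (lft e))"
  proof (cases "x = X (lft e)")
    case False
    then show ?thesis
      using height_diff_antimono[OF e f crossing_centres[OF ef], of "X (lft e)" x] xy near near' by force
  qed simp
  have right: "height e (X (rgt e)) - height f (X (rgt e)) \<le> height e y - height f y"
  proof (cases "y = X (rgt e)")
    case False
    then show ?thesis
      using height_diff_antimono[OF e f crossing_centres[OF ef], of y "X (rgt e)"] xy near near' by force
  qed simp
  show "Y (lft e) > height f (X (lft e))" "Y (rgt e) < height f (X (rgt e))"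
    using left right xy F by linarith+
  \<comment> \<open>At \<open>x\<close> the arc of \<open>f\<close> is below that of
    \<open>e\<close>, so the centre of \<open>f\<close> is less than 1/10 above the centre of
    \<open>e\<close>, whereas the endpoints of \<open>e\<close> are at least 9/10 above it. Above
    the centre of \<open>f\<close>, its cap decides between inside and outside of the
    circle.\<close>
  have "Y (fst e) + 1 \<ge> height e x" "height f x \<ge> Y (fst f) + 9/10"
    "height e (X (lft e)) \<ge> Y (fst e) + 9/10" "height e (X (rgt e)) \<ge> Y (fst e) + 9/10"
    unfolding height_def using near by (auto intro: cap_le cap_ge)
  then show "Y (lft e) \<ge> Y (fst f)" "Y (rgt e) \<ge> Y (fst f)" using F xy by linarith+
qed

lemma crossing_separates:
  assumes ef: "(e, f) \<in> crossings"
  shows "1 < dsq (fst f) (lft e)" "dsq (fst f) (rgt e) < 1"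
  using crossing_heights[OF ef] above_cap_outside below_cap_inside
  by (auto simp: dsq_def height_def)

lemma endpoint_dsq:
  assumes "e \<in> E"
  shows "dsq (fst e) (lft e) = 1" "dsq (fst e) (rgt e) = 1"
proof -
  have "\<bar>X (lft e) - X (fst e)\<bar> \<le> 1" "\<bar>X (rgt e) - X (fst e)\<bar> \<le> 1"
    using arc_near_centre[OF assms, of "X (lft e)"] arc_near_centre[OF assms, of "X (rgt e)"]
      arc_facts(4)[OF assms] by linarith+
  then show "dsq (fst e) (lft e) = 1" "dsq (fst e) (rgt e) = 1"
    using arc_facts(5,6)[OF assms] cap_on_circle unfolding dsq_def height_def by metis+
qed

text \<open>The endpoints of \<open>f\<close> lie on its circle, those of \<open>e\<close> do not.
  Four distinct points give a crossing the sampling weight \<open>1 / m ^ 4\<close>.\<close>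

lemma crossing_endpoints:
  assumes ef: "(e, f) \<in> crossings"
  shows "card {lft e, rgt e, lft f, rgt f} = 4"
proof -
  note e = crossings_E(1)[OF ef] and f = crossings_E(2)[OF ef]
  have "lft e \<noteq> rgt e" "lft f \<noteq> rgt f" using arc_facts(4)[OF e] arc_facts(4)[OF f] by auto
  moreover have "lft e \<noteq> lft f" "lft e \<noteq> rgt f" "rgt e \<noteq> lft f" "rgt e \<noteq> rgt f"
    using crossing_separates[OF ef] endpoint_dsq[OF f] by auto
  ultimately show ?thesis by simp
qed

text \<open>After crossing \<open>f\<close>, the arc \<open>e\<close> stays below the cap shared by
  \<open>f\<close> and \<open>g\<close>, as the difference of heights decreases; so it is not above
  it at the later arc \<open>g\<close>.\<close>

lemma crossings_same_circle:
  assumes c: "(e, f) \<in> crossings" "(e, g) \<in> crossings" and p: "fst f = fst g"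
    and le: "X (rgt f) \<le> X (lft g)"
  shows False
proof -
  obtain x y where e: "e \<in> E" and f: "f \<in> E" and xy: "x < y" "X (lft e) \<le> x" "X (lft f) \<le> x"
    "y \<le> X (rgt e)" "y \<le> X (rgt f)" "height f x < height e x" "height e y < height f y"
    using c(1) unfolding crossings_def by blast
  obtain x' y' where g: "g \<in> E" and xy': "x' < y'" "X (lft e) \<le> x'" "X (lft g) \<le> x'"
    "y' \<le> X (rgt e)" "y' \<le> X (rgt g)" "height g x' < height e x'" "height e y' < height g y'"
    using c(2) unfolding crossings_def by blast
  have h: "height g = height f" using p by (simp add: height_def)
  have "y \<le> x'" using le xy xy' by linarith
  have near: "\<bar>y - X (fst e)\<bar> < 1" "\<bar>y - X (fst f)\<bar> < 1" "\<bar>x' - X (fst e)\<bar> < 1" "\<bar>x' - X (fst f)\<bar> < 1"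
    using arc_near_centre[OF e, of y] arc_near_centre[OF e, of x']
      arc_near_centre[OF f, of y] arc_near_centre[OF g, of x', folded p] xy xy' by linarith+
  have "height e x' - height f x' \<le> height e y - height f y"
  proof (cases "y = x'")
    case False
    then have "y < x'" using \<open>y \<le> x'\<close> by simp
    from height_diff_antimono[OF e f crossing_centres[OF c(1)] this near] show ?thesis by simp
  qed simp
  then show False using xy xy' unfolding h by linarith
qed

lemma inj_on_crossing_centre: "inj_on (\<lambda>(e, f). (e, fst f)) crossings"
proof (rule inj_onI, rule ccontr)
  fix c d assume c: "c \<in> crossings" "d \<in> crossings"
    "(case c of (e, f) \<Rightarrow> (e, fst f)) = (case d of (e, f) \<Rightarrow> (e, fst f))" "c \<noteq> d"
  obtain e f e' g where eq: "c = (e, f)" "d = (e', g)" by (metis surj_pair)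
  then have "e' = e" "fst f = fst g" "f \<noteq> g" using c by simp_all
  then show False
    using same_circle_disjoint[of f g] crossings_same_circle[of e f g] crossings_same_circle[of e g f]
      crossings_E[of e f] crossings_E[of e g] c(1,2) unfolding eq by metis
qed

lemma finite_crossings: "finite crossings"
  by (rule finite_subset[of _ "E \<times> E"]) (use finite_E crossings_E in auto)

text \<open>A crossing \<open>(e, f)\<close> is charged to \<open>e\<close> and the centre of
  \<open>f\<close>, injectively by \<open>inj_on_crossing_centre\<close>. Only points of
  \<open>S\<close> occur as centres, which sharpens the bound when there are few of them.\<close>

lemma card_crossings_le:
  assumes S: "S \<subseteq> P" "fst ` E \<subseteq> S"
  shows "card crossings \<le> (\<Sum>e\<in>E. card {x \<in> S. separates x (lft e) (rgt e)})"
proof -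
  have finS: "finite S" using S(1) finite_P by (rule finite_subset)
  have "card crossings \<le> card (SIGMA e:E. {x \<in> S. separates x (lft e) (rgt e)})"
  proof (rule card_inj_on_le[OF inj_on_crossing_centre])
    show "(\<lambda>(e, f). (e, fst f)) ` crossings \<subseteq> (SIGMA e:E. {x \<in> S. separates x (lft e) (rgt e)})"
    proof (rule image_subsetI)
      fix c assume "c \<in> crossings"
      then obtain e f where c: "c = (e, f)" "(e, f) \<in> crossings" by (cases c) simp
      then have "fst f \<in> S" using crossings_E(2) S(2) by blast
      moreover have "separates (fst f) (lft e) (rgt e)"
        using crossing_separates[OF c(2)] by (simp add: separates_def)
      ultimately show "(case c of (e, f) \<Rightarrow> (e, fst f)) \<in> (SIGMA e:E. {x \<in> S. separates x (lft e) (rgt e)})"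
        using c crossings_E(1) by simp
    qed
    show "finite (SIGMA e:E. {x \<in> S. separates x (lft e) (rgt e)})"
      using finite_E finS by auto
  qed
  also have "\<dots> = (\<Sum>e\<in>E. card {x \<in> S. separates x (lft e) (rgt e)})"
    using finite_E finS by (simp add: card_SigmaI)
  finally show ?thesis .
qed

lemma uncrossed_order:
  assumes "e \<in> E" "f \<in> E" "(e, f) \<notin> crossings" "(f, e) \<notin> crossings"
    "X (lft e) \<le> x" "X (lft f) \<le> x" "x \<le> X (rgt e)" "x \<le> X (rgt f)"
    "X (lft e) \<le> y" "X (lft f) \<le> y" "y \<le> X (rgt e)" "y \<le> X (rgt f)" "height e x < height f x"
  shows "height e y \<le> height f y"
proof (rule ccontr)
  assume n: "\<not> ?thesis"
  then consider "x < y" | "y < x" using assms(13) by fastforce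
  then show False
    using crossingsI[of f e x y] crossingsI[of e f y x] assms n by cases simp_all
qed

lemma height_diff_antimono_common:
  assumes e: "e \<in> E" and f: "f \<in> E" and less: "X (fst e) < X (fst f)" and xy: "x < y"
    and "X (lft e) \<le> x" "X (lft f) \<le> x" "y \<le> X (rgt e)" "y \<le> X (rgt f)"
  shows "height e y - height f y < height e x - height f x"
proof (rule height_diff_antimono[OF e f less xy])
  show "\<bar>x - X (fst e)\<bar> < 1" "\<bar>x - X (fst f)\<bar> < 1" "\<bar>y - X (fst e)\<bar> < 1" "\<bar>y - X (fst f)\<bar> < 1"
    using arc_near_centre[OF e, of x] arc_near_centre[OF e, of y]
      arc_near_centre[OF f, of x] arc_near_centre[OF f, of y] assms by linarith+
qed

lemma meeting_centres_neq:
  assumes e: "e \<in> E" and f: "f \<in> E" and ne: "e \<noteq> f" and xy: "x < y"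
    and common: "X (lft e) \<le> x" "X (lft f) \<le> x" "y \<le> X (rgt e)" "y \<le> X (rgt f)"
    and eq: "height e t = height f t"
  shows "X (fst e) \<noteq> X (fst f)"
proof
  assume X: "X (fst e) = X (fst f)"
  then have "Y (fst e) = Y (fst f)" using eq by (simp add: height_def cap_def)
  then have "fst e = fst f" using point_eqI X arc_facts(1) e f by blast
  from same_circle_disjoint[OF e f this ne] show False using xy common by linarith
qed

lemma arcs_meet_once:
  assumes "e \<in> E" "f \<in> E" "e \<noteq> f" "X (lft e) \<le> x" "X (lft f) \<le> x" "x < y"
    "y \<le> X (rgt e)" "y \<le> X (rgt f)" "height e x = height f x"
  shows "height e y \<noteq> height f y"
proof -
  consider "X (fst e) < X (fst f)" | "X (fst f) < X (fst e)"
    using meeting_centres_neq[OF assms(1-3,6,4,5,7-9)] by linarith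
  then show ?thesis
    using height_diff_antimono_common[of e f x y] height_diff_antimono_common[of f e x y] assms
    by cases simp_all
qed

text \<open>The strictly decreasing difference of heights vanishes inside the common interval, so it
  is positive at its left end \<open>a\<close> and negative at its right end
  \<open>b\<close>.\<close>

lemma inner_meet_crosses_ordered:
  assumes e: "e \<in> E" and f: "f \<in> E" and less: "X (fst e) < X (fst f)"
    and x: "X (lft e) < x" "X (lft f) < x" "x < X (rgt e)" "x < X (rgt f)"
    and eq: "height e x = height f x"
  shows "(e, f) \<in> crossings"
proof -
  define a b where "a = max (X (lft e)) (X (lft f))" and "b = min (X (rgt e)) (X (rgt f))"
  have ab: "a < x" "x < b" "X (lft e) \<le> a" "X (lft f) \<le> a" "b \<le> X (rgt e)" "b \<le> X (rgt f)"
    using x by (auto simp: a_def b_def)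
  have "height e x - height f x < height e a - height f a"
    by (rule height_diff_antimono_common[OF e f less ab(1,3,4)]) (use x in simp_all)
  moreover have "height e b - height f b < height e x - height f x"
    by (rule height_diff_antimono_common[OF e f less ab(2) _ _ ab(5,6)]) (use x in simp_all)
  ultimately show ?thesis using ab eq by (intro crossingsI[OF e f, of a b]) simp_all
qed

lemma inner_meet_crosses:
  assumes "e \<in> E" "f \<in> E" "e \<noteq> f" "X (lft e) < x" "X (lft f) < x" "x < X (rgt e)" "x < X (rgt f)"
    "height e x = height f x"
  shows "(e, f) \<in> crossings \<or> (f, e) \<in> crossings"
proof -
  have "X (fst e) \<noteq> X (fst f)"
    by (rule meeting_centres_neq[of e f "max (X (lft e)) (X (lft f))" x x]) (use assms in simp_all)
  then consider "X (fst e) < X (fst f)" | "X (fst f) < X (fst e)" by linarith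
  then show ?thesis
    using inner_meet_crosses_ordered[of e f x] inner_meet_crosses_ordered[of f e x] assms
    by cases simp_all
qed

lemma non_crossing_drawing:
  assumes V: "V \<subseteq> P" and D: "D \<subseteq> E" "\<And>e. e \<in> D \<Longrightarrow> lft e \<in> V \<and> rgt e \<in> V"
    and nc: "\<And>e f. e \<in> D \<Longrightarrow> f \<in> D \<Longrightarrow> (e, f) \<notin> crossings"
  shows "monotone_drawing V X Y D lft rgt height"
proof (unfold_locales, goal_cases)
  case 1 then show ?case using V finite_P by (rule finite_subset)
next
  case 2 then show ?case using D(1) finite_E by (rule finite_subset)
next
  case 3 then show ?case using inj_XY V by (rule inj_on_subset)
next
  case 9 then show ?case using arc_inner_empty D(1) V by blast
next
  case (10 e f x y) then show ?case using uncrossed_order[of e f x y] nc D(1) by blast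
next
  case (11 e f x y) then show ?case using arcs_meet_once[of e f x y] D(1) by blast
next
  case (12 e f x) then show ?case using inner_meet_crosses[of e f x] nc D(1) by blast
qed (use D arc_facts in blast)+

text \<open>Delete the first arc of every crossing that has all four endpoints in \<open>V\<close>;
  the remaining arcs form a non-crossing drawing.\<close>

lemma sampled_bound:
  assumes V: "V \<subseteq> P"
  shows "card {e \<in> E. {lft e, rgt e} \<subseteq> V}
    \<le> 3 * card V + card {c \<in> crossings. {lft (fst c), rgt (fst c), lft (snd c), rgt (snd c)} \<subseteq> V}"
proof -
  let ?EV = "{e \<in> E. {lft e, rgt e} \<subseteq> V}"
  let ?FV = "{c \<in> crossings. {lft (fst c), rgt (fst c), lft (snd c), rgt (snd c)} \<subseteq> V}"
  have finF: "finite ?FV" by (rule finite_subset[OF _ finite_crossings]) auto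
  let ?D = "?EV - fst ` ?FV"
  have "monotone_drawing V X Y ?D lft rgt height"
  proof (rule non_crossing_drawing[OF V])
    show "(e, f) \<notin> crossings" if "e \<in> ?D" "f \<in> ?D" for e f
    proof
      assume "(e, f) \<in> crossings"
      then have "(e, f) \<in> ?FV" using that by simp
      then have "e \<in> fst ` ?FV" by (rule image_eqI[rotated]) simp
      then show False using that by blast
    qed
  qed auto
  then have "card ?D \<le> 3 * card V" by (rule monotone_drawing.card_edges_le)
  moreover have "card ?EV \<le> card ?D + card (fst ` ?FV)"
    using diff_card_le_card_Diff[of "fst ` ?FV" ?EV] finF by simp
  moreover have "card (fst ` ?FV) \<le> card ?FV" by (rule card_image_le[OF finF])
  ultimately show ?thesis by linarith
qed

theorem card_arcs_le:
  assumes S: "S \<subseteq> P" "fst ` E \<subseteq> S" and m: "m > (0::nat)"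
  shows "real (card E) \<le> 3 * real (card P) * real m
    + (\<Sum>e\<in>E. real (card {x \<in> S. separates x (lft e) (rgt e)})) / real m ^ 2"
proof -
  have "real (card E) \<le> 3 * real (card P) * real m + real (card crossings) / real m ^ 2"
  proof (rule random_sample_amplification[OF finite_P finite_E finite_crossings m,
        of "\<lambda>e. {lft e, rgt e}" "\<lambda>c. {lft (fst c), rgt (fst c), lft (snd c), rgt (snd c)}"])
    show "{lft e, rgt e} \<subseteq> P \<and> card {lft e, rgt e} = 2" if "e \<in> E" for e
    proof -
      have "lft e \<noteq> rgt e" using arc_facts(4)[OF that] by auto
      then show ?thesis using arc_facts(2,3)[OF that] by simp
    qed
    show "{lft (fst c), rgt (fst c), lft (snd c), rgt (snd c)} \<subseteq> P \<and> card {lft (fst c), rgt (fst c), lft (snd c), rgt (snd c)} = 4"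
      if "c \<in> crossings" for c
    proof -
      have c: "(fst c, snd c) \<in> crossings" using that by simp
      then show ?thesis
        using crossing_endpoints[OF c] arc_facts(2,3)[OF crossings_E(1)[OF c]]
          arc_facts(2,3)[OF crossings_E(2)[OF c]] by blast
    qed
    show "real (card {e \<in> E. {lft e, rgt e} \<subseteq> V}) \<le> 3 * real (card V) +
      real (card {c \<in> crossings. {lft (fst c), rgt (fst c), lft (snd c), rgt (snd c)} \<subseteq> V})" if "V \<subseteq> P" for V
      using of_nat_mono[OF sampled_bound[OF that]] unfolding of_nat_add of_nat_mult of_nat_numeral .
  qed
  also have "real (card crossings) \<le> (\<Sum>e\<in>E. real (card {x \<in> S. separates x (lft e) (rgt e)}))"
    using of_nat_mono[OF card_crossings_le[OF S]] unfolding of_nat_sum .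
  finally show ?thesis by (simp add: divide_right_mono)
qed

section \<open>Total number of points in lunes\<close>

text \<open>By the intermediate value theorem the unit circle of a separating \<open>x\<close> meets
  the interior of the arc. Arcs of one circle have disjoint interiors, so they use different common
  points of two distinct circles, of which there are at most two.\<close>

lemma separated_pairs_on_circle:
  assumes p: "p \<in> P" and x: "x \<in> P"
  shows "card {e \<in> E. fst e = p \<and> separates x (lft e) (rgt e)} \<le> 2"
proof (cases "x = p")
  case True
  have "\<not> separates x (lft e) (rgt e)" if "e \<in> E" "fst e = p" for e
    using endpoint_dsq[OF that(1)] that(2) True by (simp add: separates_def)
  then have "{e \<in> E. fst e = p \<and> separates x (lft e) (rgt e)} = {}" by blast
  then show ?thesis by (simp only: card.empty)
next
  case False
  let ?A = "{e \<in> E. fst e = p \<and> separates x (lft e) (rgt e)}"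
  let ?I = "{(u, v). (u - X p)\<^sup>2 + (v - Y p)\<^sup>2 = 1 \<and> (u - X x)\<^sup>2 + (v - Y x)\<^sup>2 = 1}"
  have ne: "(X p, Y p) \<noteq> (X x, Y x)" using point_eqI[OF x p] False by auto
  have I: "finite ?I" "card ?I \<le> 2" by (rule two_unit_circles[OF ne])+
  have "\<exists>u. X (lft e) < u \<and> u < X (rgt e) \<and> (u, height e u) \<in> ?I" if e: "e \<in> ?A" for e
  proof -
    have eE: "e \<in> E" using e by simp
    define g where "g = (\<lambda>u. (u - X x)\<^sup>2 + (height e u - Y x)\<^sup>2)"
    have cont: "continuous_on A g" for A unfolding g_def height_def by (intro continuous_intros)
    have ends: "g (X (lft e)) = dsq x (lft e)" "g (X (rgt e)) = dsq x (rgt e)"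
      using arc_facts[OF eE] by (auto simp: g_def dsq_def)
    have sep: "g (X (lft e)) < 1 \<and> 1 < g (X (rgt e)) \<or> g (X (rgt e)) < 1 \<and> 1 < g (X (lft e))"
      using e unfolding ends separates_def by blast
    have le: "X (lft e) \<le> X (rgt e)" using arc_facts(4)[OF eE] by simp
    have "\<exists>u. X (lft e) \<le> u \<and> u \<le> X (rgt e) \<and> g u = 1"
      using sep
    proof
      assume "g (X (lft e)) < 1 \<and> 1 < g (X (rgt e))"
      then show ?thesis by (intro IVT'[OF _ _ le cont]) simp_all
    next
      assume "g (X (rgt e)) < 1 \<and> 1 < g (X (lft e))"
      then show ?thesis by (intro IVT2'[OF _ _ le cont]) simp_all
    qed
    then obtain u where u: "X (lft e) \<le> u" "u \<le> X (rgt e)" "g u = 1" by blast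
    have "u \<noteq> X (lft e)" "u \<noteq> X (rgt e)" using u sep by auto
    then have "X (lft e) < u" "u < X (rgt e)" using u by linarith+
    moreover have "(u, height e u) \<in> ?I"
    proof -
      have p: "fst e = p" using e by simp
      have "(u - X p)\<^sup>2 + (height e u - Y p)\<^sup>2 = 1"
        unfolding height_def p
        by (rule cap_on_circle) (use arc_near_centre[OF eE u(1,2)] p in simp)
      then show ?thesis using u(3) by (simp add: g_def)
    qed
    ultimately show ?thesis by blast
  qed
  then have "\<forall>e\<in>?A. \<exists>u. X (lft e) < u \<and> u < X (rgt e) \<and> (u, height e u) \<in> ?I" by (rule ballI)
  from bchoice[OF this] obtain c
    where c: "\<forall>e\<in>?A. X (lft e) < c e \<and> c e < X (rgt e) \<and> (c e, height e (c e)) \<in> ?I" ..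
  have "inj_on (\<lambda>e. (c e, height e (c e))) ?A"
  proof (rule inj_onI, rule ccontr)
    fix e f assume ef: "e \<in> ?A" "f \<in> ?A" "(c e, height e (c e)) = (c f, height f (c f))" "e \<noteq> f"
    then have "e \<in> E" "f \<in> E" "fst e = fst f" "c e = c f" by simp_all
    then show False using same_circle_disjoint[of e f] bspec[OF c ef(1)] bspec[OF c ef(2)] ef(4) by linarith
  qed
  then have "card ?A \<le> card ?I" using c I(1) by (intro card_inj_on_le[of "\<lambda>e. (c e, height e (c e))"] image_subsetI) blast+
  then show ?thesis using I(2) by simp
qed

lemma sum_separated_le:
  assumes S: "S \<subseteq> P" "fst ` E \<subseteq> S"
  shows "(\<Sum>e\<in>E. card {x \<in> S. separates x (lft e) (rgt e)}) \<le> 2 * (card S)\<^sup>2"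
proof -
  have finS: "finite S" using S(1) finite_P by (rule finite_subset)
  have "(\<Sum>e\<in>E. card {x \<in> S. separates x (lft e) (rgt e)})
      = (\<Sum>p\<in>S. \<Sum>e\<in>{e \<in> E. fst e = p}. card {x \<in> S. separates x (lft e) (rgt e)})"
    by (rule sum.group[OF finite_E finS S(2), symmetric])
  also have "\<dots> = (\<Sum>p\<in>S. \<Sum>x\<in>S. card {e \<in> E. fst e = p \<and> separates x (lft e) (rgt e)})"
  proof (rule sum.cong[OF refl])
    fix p
    have "(\<Sum>e\<in>{e \<in> E. fst e = p}. card {x \<in> S. separates x (lft e) (rgt e)})
        = (\<Sum>e\<in>{e \<in> E. fst e = p}. \<Sum>x\<in>S. if separates x (lft e) (rgt e) then 1 else 0)"
      using finS by (simp add: sum.If_cases Int_def)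
    also have "\<dots> = (\<Sum>x\<in>S. \<Sum>e\<in>{e \<in> E. fst e = p}. if separates x (lft e) (rgt e) then 1 else 0)"
      by (rule sum.swap)
    also have "\<dots> = (\<Sum>x\<in>S. card {e \<in> E. fst e = p \<and> separates x (lft e) (rgt e)})"
      using finite_E by (simp add: sum.If_cases Int_def conj_assoc)
    finally show "(\<Sum>e\<in>{e \<in> E. fst e = p}. card {x \<in> S. separates x (lft e) (rgt e)})
        = (\<Sum>x\<in>S. card {e \<in> E. fst e = p \<and> separates x (lft e) (rgt e)})" .
  qed
  also have "\<dots> \<le> (\<Sum>p\<in>S. \<Sum>x\<in>S. 2)"
    using S(1) by (intro sum_mono separated_pairs_on_circle) auto
  finally show ?thesis by (simp add: power2_eq_square)
qed

lemma restrict_arcs: "D \<subseteq> E \<Longrightarrow> upper_arcs P X Y D"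
  using finite_P inj_XY arc_points arc_width arc_cap arc_empty by unfold_locales blast+

end

section \<open>Sectors of unit circles\<close>

text \<open>With \<open>radial\<close>, an orthogonal coordinate system in which the direction
  \<open>\<theta>\<close> points upwards. For \<open>\<theta>\<close> the middle of a sector, the
  arcs of that sector lie on upper caps.\<close>

definition tang :: "real \<Rightarrow> real ^ 2 \<Rightarrow> real" where
  "tang \<theta> z = cos \<theta> * z $ 2 - sin \<theta> * z $ 1"

definition radial :: "real \<Rightarrow> real ^ 2 \<Rightarrow> real" where
  "radial \<theta> z = cos \<theta> * z $ 1 + sin \<theta> * z $ 2"

lemma dist_tang_radial: "(tang \<theta> z - tang \<theta> w)\<^sup>2 + (radial \<theta> z - radial \<theta> w)\<^sup>2 = (dist z w)\<^sup>2"
proof -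
  define u v where "u = z $ 1 - w $ 1" and "v = z $ 2 - w $ 2"
  have eq: "tang \<theta> z - tang \<theta> w = cos \<theta> * v - sin \<theta> * u" "radial \<theta> z - radial \<theta> w = cos \<theta> * u + sin \<theta> * v"
    by (simp_all add: tang_def radial_def u_def v_def algebra_simps)
  have "(tang \<theta> z - tang \<theta> w)\<^sup>2 + (radial \<theta> z - radial \<theta> w)\<^sup>2 = ((sin \<theta>)\<^sup>2 + (cos \<theta>)\<^sup>2) * (u\<^sup>2 + v\<^sup>2)"
    unfolding eq power2_eq_square by algebra
  also have "\<dots> = (dist z w)\<^sup>2"
    by (simp add: u_def v_def dist_vec_def L2_set_def sum_2 dist_real_def)
  finally show ?thesis .
qed

lemma tang_radial_eqI:
  assumes "tang \<theta> z = tang \<theta> w" "radial \<theta> z = radial \<theta> w"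
  shows "z = w"
  using dist_tang_radial[of \<theta> z w] assms by simp

lemma tang_circle_point: "tang \<theta> (circle_point p t) = tang \<theta> p + sin (t - \<theta>)"
  by (simp add: tang_def circle_point_def sin_diff algebra_simps)

lemma radial_circle_point: "radial \<theta> (circle_point p t) = radial \<theta> p + cos (t - \<theta>)"
  by (simp add: radial_def circle_point_def cos_diff algebra_simps)

lemma dist_circle_point: "dist p (circle_point p t) = 1"
proof -
  have "(dist (circle_point p t) p)\<^sup>2 = 1"
    using dist_tang_radial[of 0 "circle_point p t" p] by (simp add: tang_circle_point radial_circle_point)
  then show ?thesis by (metis dist_commute one_power2 power2_eq_imp_eq zero_le_dist zero_le_one)
qed

lemma circle_point_inj:
  assumes "circle_point p s = circle_point p t" "0 \<le> s" "s < 2 * pi" "0 \<le> t" "t < 2 * pi"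
  shows "s = t"
proof -
  have "sin s = sin t" "cos s = cos t"
    using assms(1) tang_circle_point[of 0 p s] tang_circle_point[of 0 p t]
      radial_circle_point[of 0 p s] radial_circle_point[of 0 p t] by simp_all
  then obtain n :: int where n: "s = t + 2 * pi * n" using sin_cos_eq_iff by metis
  have "2 * pi * n < 2 * pi * 1" "2 * pi * (-1) < 2 * pi * n" using n assms by linarith+
  then have "real_of_int n < 1" "-1 < real_of_int n" 
    using mult_less_cancel_left_pos[of "2 * pi" "real_of_int n" 1]
      mult_less_cancel_left_pos[of "2 * pi" "-1" "real_of_int n"] by simp_all
  then have "n = 0" by linarith
  then show ?thesis using n by simp
qed

lemma circle_point_surj:
  assumes "dist p q = 1"
  obtains t where "0 \<le> t" "t < 2 * pi" "q = circle_point p t"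
proof -
  have "(radial 0 q - radial 0 p)\<^sup>2 + (tang 0 q - tang 0 p)\<^sup>2 = 1"
    using dist_tang_radial[of 0 q p] assms by (simp add: dist_commute)
  then obtain t where t: "0 \<le> t" "t < 2 * pi" "radial 0 q - radial 0 p = cos t" "tang 0 q - tang 0 p = sin t"
    using sincos_total_2pi by blast
  have "q = circle_point p t"
    by (rule tang_radial_eqI[of 0]) (use t tang_circle_point[of 0 p t] radial_circle_point[of 0 p t] in simp_all)
  then show ?thesis using t that by blast
qed

text \<open>Half-open, so that the sectors with \<open>j < 12\<close> partition the angles
  \<open>t\<close> with \<open>0 \<le> t\<close> and \<open>t < 2 * pi\<close>.\<close>

definition sector :: "nat \<Rightarrow> real set" where
  "sector j = {real j * (pi / 6) ..< real (Suc j) * (pi / 6)}"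

definition mid :: "nat \<Rightarrow> real" where
  "mid j = (real j + 1/2) * (pi / 6)"

text \<open>Arcs between different sectors are left out; since \<open>k\<close> points in a sector
  still give \<open>k - 1\<close> arcs, at most 12 points per circle go uncounted.\<close>

definition sector_arcs :: "(real ^ 2) set \<Rightarrow> nat \<Rightarrow> ((real ^ 2) \<times> (real ^ 2) \<times> (real ^ 2)) set" where
  "sector_arcs P j = {(p, circle_point p a, circle_point p b) | p a b.
     p \<in> P \<and> circle_point p a \<in> P \<and> circle_point p b \<in> P \<and> a \<in> sector j \<and> b \<in> sector j \<and> a < b \<and>
     (\<forall>t. a < t \<and> t < b \<longrightarrow> circle_point p t \<notin> P)}"

lemma sector_arcsE:
  assumes "(p, q, r) \<in> sector_arcs P j"
  obtains a b where "p \<in> P" "q \<in> P" "r \<in> P" "q = circle_point p a" "r = circle_point p b"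
    "a \<in> sector j" "b \<in> sector j" "a < b" "\<forall>t. a < t \<and> t < b \<longrightarrow> circle_point p t \<notin> P"
  using assms unfolding sector_arcs_def by blast

lemma sector_mid: "t \<in> sector j \<Longrightarrow> \<bar>t - mid j\<bar> \<le> pi / 12"
proof -
  assume "t \<in> sector j"
  moreover have "mid j = real j * (pi / 6) + pi / 12" "real (Suc j) * (pi / 6) = real j * (pi / 6) + pi / 6"
    by (simp_all add: mid_def algebra_simps)
  ultimately show ?thesis by (simp only: sector_def atLeastLessThan_iff) linarith
qed

lemma pi_less: "pi < 63/20"
  using pi_approx by simp

lemma sector_sin_cos:
  assumes "\<bar>u\<bar> \<le> pi / 12"
  shows "\<bar>sin u\<bar> \<le> 3/10" "cos u = sqrt (1 - (sin u)\<^sup>2)"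
proof -
  \<comment> \<open>\<open>pi / 12 < 63 / 240 < 3 / 10\<close>: this ties the number of sectors to
    the width required in \<open>upper_arcs\<close>.\<close>
  show "\<bar>sin u\<bar> \<le> 3/10" using abs_sin_x_le_abs_x[of u] assms pi_less by linarith
  have "0 \<le> cos u" using assms by (intro cos_ge_zero) auto
  then show "cos u = sqrt (1 - (sin u)\<^sup>2)" by (simp add: sin_squared_eq)
qed

lemma sector_subset: "j < 12 \<Longrightarrow> t \<in> sector j \<Longrightarrow> 0 \<le> t \<and> t < 2 * pi"
proof -
  assume j: "j < 12" and t: "t \<in> sector j"
  have "real (Suc j) * (pi / 6) \<le> 12 * (pi / 6)" using j by (intro mult_right_mono) auto
  moreover have "0 \<le> real j * (pi / 6)" by simp
  ultimately show ?thesis using t by (simp only: sector_def atLeastLessThan_iff) linarith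
qed

lemma circle_point_on_cap:
  assumes "t \<in> sector j"
  shows "\<bar>tang (mid j) (circle_point p t) - tang (mid j) p\<bar> \<le> 3/10"
    "radial (mid j) (circle_point p t) =
      cap (tang (mid j) p) (radial (mid j) p) (tang (mid j) (circle_point p t))"
  using sector_sin_cos[OF sector_mid[OF assms]]
  by (simp_all add: tang_circle_point radial_circle_point cap_def)

lemma sin_mid_less_iff:
  assumes "\<bar>s\<bar> \<le> pi / 12" "\<bar>t\<bar> \<le> pi / 12"
  shows "sin s < sin t \<longleftrightarrow> s < t"
  using assms by (intro sin_mono_less_eq) auto

lemma sector_upper_arcs:
  assumes P: "finite P"
  shows "upper_arcs P (tang (mid j)) (radial (mid j)) (sector_arcs P j)"
proof
  show "finite P" by fact
  show "inj_on (\<lambda>z. (tang (mid j) z, radial (mid j) z)) P"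
    using tang_radial_eqI by (auto intro!: inj_onI)
  fix p q r assume e: "(p, q, r) \<in> sector_arcs P j"
  then obtain a b where ab: "p \<in> P" "q \<in> P" "r \<in> P" "q = circle_point p a" "r = circle_point p b"
    "a \<in> sector j" "b \<in> sector j" "a < b" "\<forall>t. a < t \<and> t < b \<longrightarrow> circle_point p t \<notin> P"
    by (rule sector_arcsE)
  note mids = sector_mid[OF ab(6)] sector_mid[OF ab(7)]
  show "p \<in> P \<and> q \<in> P \<and> r \<in> P \<and> tang (mid j) q < tang (mid j) r"
    using ab sin_mid_less_iff[OF mids] by (simp add: tang_circle_point)
  show "\<bar>tang (mid j) q - tang (mid j) p\<bar> \<le> 3/10 \<and> \<bar>tang (mid j) r - tang (mid j) p\<bar> \<le> 3/10"
    using ab circle_point_on_cap(1) by simp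
  show "radial (mid j) q = cap (tang (mid j) p) (radial (mid j) p) (tang (mid j) q) \<and>
      radial (mid j) r = cap (tang (mid j) p) (radial (mid j) p) (tang (mid j) r)"
    using ab circle_point_on_cap(2) by simp
  fix z assume z: "z \<in> P" "tang (mid j) q < tang (mid j) z" "tang (mid j) z < tang (mid j) r"
  show "radial (mid j) z \<noteq> cap (tang (mid j) p) (radial (mid j) p) (tang (mid j) z)"
  proof
    assume cap: "radial (mid j) z = cap (tang (mid j) p) (radial (mid j) p) (tang (mid j) z)"
    define u where "u = tang (mid j) z - tang (mid j) p"
    have u: "sin (a - mid j) < u" "u < sin (b - mid j)"
      using z ab by (simp_all add: u_def tang_circle_point)
    have u1: "-1 \<le> u" "u \<le> 1" using u sin_ge_minus_one[of "a - mid j"] sin_le_one[of "b - mid j"] by linarith+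
    \<comment> \<open>The point of the cap at offset \<open>u\<close> has angle
      \<open>mid j + arcsin u\<close>, so \<open>z\<close> would sit strictly between
      \<open>q\<close> and \<open>r\<close> on the circle.\<close>
    define s where "s = arcsin u"
    have s: "sin s = u" "cos s = sqrt (1 - u\<^sup>2)"
      using u1 by (simp_all add: s_def cos_arcsin)
    have "\<bar>s\<bar> \<le> pi / 2"
      using arcsin_bounded[OF u1] unfolding s_def by linarith
    have "z = circle_point p (mid j + s)"
      by (rule tang_radial_eqI[of "mid j"])
        (use s cap in \<open>simp_all add: tang_circle_point radial_circle_point u_def cap_def\<close>)
    moreover have "a - mid j < s" "s < b - mid j"
      using u \<open>\<bar>s\<bar> \<le> pi / 2\<close> mids pi_gt_zero
        sin_mono_less_eq[of "a - mid j" s] sin_mono_less_eq[of s "b - mid j"]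
      unfolding s(1) by linarith+
    ultimately show False using spec[OF ab(9), of "mid j + s"] z(1) by auto
  qed
qed

lemma sector_arc_consecutive:
  assumes j: "j < 12" and e: "(p, q, r) \<in> sector_arcs P j"
  shows "consecutive_on_circle P p q r" "dist q r < 1"
proof -
  from e obtain a b where ab: "p \<in> P" "q \<in> P" "r \<in> P" "q = circle_point p a" "r = circle_point p b"
    "a \<in> sector j" "b \<in> sector j" "a < b" "\<forall>t. a < t \<and> t < b \<longrightarrow> circle_point p t \<notin> P"
    by (rule sector_arcsE)
  have "b < a + 2 * pi" using sector_subset[OF j ab(6)] sector_subset[OF j ab(7)] by linarith
  then have "\<exists>a b. a < b \<and> b < a + 2 * pi \<and> q = circle_point p a \<and> r = circle_point p b \<and>
      (\<forall>t. a < t \<and> t < b \<longrightarrow> circle_point p t \<notin> P)"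
    using ab by (intro exI[of _ a] exI[of _ b] conjI)
  then have "next_on_circle P p q r"
    using ab(2-5) dist_circle_point unfolding next_on_circle_def unit_circle_def by simp
  then show "consecutive_on_circle P p q r" by (simp add: consecutive_on_circle_def)
  have X: "\<bar>tang (mid j) q - tang (mid j) p\<bar> \<le> 3/10" "\<bar>tang (mid j) r - tang (mid j) p\<bar> \<le> 3/10"
    using ab circle_point_on_cap(1) by simp_all
  have Y: "radial (mid j) q = cap (tang (mid j) p) (radial (mid j) p) (tang (mid j) q)"
    "radial (mid j) r = cap (tang (mid j) p) (radial (mid j) p) (tang (mid j) r)"
    using ab circle_point_on_cap(2) by simp_all
  \<comment> \<open>Both points are 9/10 to 1 above the centre and at most 6/10 apart horizontally,
    and \<open>0.36 + 0.01 < 1\<close>.\<close>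
  have "\<bar>radial (mid j) q - radial (mid j) r\<bar> \<le> 1/10"
    using cap_ge[OF X(1), of "radial (mid j) p"] cap_ge[OF X(2), of "radial (mid j) p"] Y
      cap_le[of "tang (mid j) p" "radial (mid j) p" "tang (mid j) q"]
      cap_le[of "tang (mid j) p" "radial (mid j) p" "tang (mid j) r"] by linarith
  moreover have "\<bar>tang (mid j) q - tang (mid j) r\<bar> \<le> 6/10" using X by linarith
  ultimately have "(tang (mid j) q - tang (mid j) r)\<^sup>2 + (radial (mid j) q - radial (mid j) r)\<^sup>2
      \<le> (6/10)\<^sup>2 + (1/10)\<^sup>2"
    by (intro add_mono) (simp_all only: power2_le_iff_abs_le[of "6/10"] power2_le_iff_abs_le[of "1/10"])
  then have "(dist q r)\<^sup>2 < 1\<^sup>2" unfolding dist_tang_radial by (simp add: power2_eq_square)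
  then show "dist q r < 1" by (rule power2_less_imp_less) simp
qed

lemma separates_iff_lunes:
  assumes "upper_arcs P (tang \<theta>) (radial \<theta>) E"
  shows "upper_arcs.separates (tang \<theta>) (radial \<theta>) x q r \<longleftrightarrow> x \<in> lunes q r"
proof -
  have "upper_arcs.dsq (tang \<theta>) (radial \<theta>) x y = (dist x y)\<^sup>2" for y
    unfolding upper_arcs.dsq_def[OF assms] dist_tang_radial by (simp add: dist_commute)
  moreover have "(dist x y)\<^sup>2 < 1 \<longleftrightarrow> dist x y < 1" "1 < (dist x y)\<^sup>2 \<longleftrightarrow> 1 < dist x y" for y
    using abs_square_less_1[of "dist x y"] abs_square_le_1[of "dist x y"]
    by (simp_all add: not_le[symmetric] del: abs_square_le_1)
  ultimately show ?thesis
    unfolding upper_arcs.separates_def[OF assms] lunes_def by simp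
qed

context
  fixes P S :: "(real ^ 2) set" and D :: "((real ^ 2) \<times> (real ^ 2) \<times> (real ^ 2)) set" and j :: nat
  assumes P: "finite P" and D: "D \<subseteq> sector_arcs P j" and S: "S \<subseteq> P" "fst ` D \<subseteq> S"
begin

interpretation upper_arcs P "tang (mid j)" "radial (mid j)" D
  by (rule upper_arcs.restrict_arcs[OF sector_upper_arcs[OF P] D])

lemma separates_lunes: "{x \<in> S. separates x q r} = lunes q r \<inter> S"
  using separates_iff_lunes[OF upper_arcs_axioms] by auto

lemma sector_arcs_bound:
  "m > (0::nat) \<Longrightarrow> real (card D) \<le> 3 * real (card P) * real m +
    (\<Sum>e\<in>D. real (card (lunes (fst (snd e)) (snd (snd e)) \<inter> S))) / real m ^ 2"
  using card_arcs_le[OF S] unfolding separates_lunes .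

lemma sector_lunes_sum:
  "(\<Sum>e\<in>D. card (lunes (fst (snd e)) (snd (snd e)) \<inter> S)) \<le> 2 * (card S)\<^sup>2"
  using sum_separated_le[OF S] unfolding separates_lunes .

text \<open>Endpoints are ordered by abscissa, so on a fixed circle no two arcs give the same
  unordered pair. This links arcs to the pairs counted in \<open>typical\<close>.\<close>

lemma inj_on_endpoints: "inj_on (\<lambda>e. {fst (snd e), snd (snd e)}) {e \<in> D. fst e = p}"
proof (rule inj_onI)
  fix e f assume e: "e \<in> {e \<in> D. fst e = p}" and f: "f \<in> {e \<in> D. fst e = p}"
    and eq: "{fst (snd e), snd (snd e)} = {fst (snd f), snd (snd f)}"
  then have "fst (snd e) = fst (snd f) \<and> snd (snd e) = snd (snd f)"
    using arc_facts(4)[of e] arc_facts(4)[of f] by (auto simp: doubleton_eq_iff)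
  then show "e = f" using e f by (simp add: prod_eq_iff)
qed

end

lemma finite_sector_arcs: "finite P \<Longrightarrow> finite (sector_arcs P j)"
  by (rule upper_arcs.finite_E[OF sector_upper_arcs])

section \<open>From unit distances to arcs\<close>

lemma finite_sector_angles:
  assumes "finite P" "j < 12"
  shows "finite {t \<in> sector j. circle_point p t \<in> P}"
proof (rule inj_on_finite[of "circle_point p" _ P])
  show "inj_on (circle_point p) {t \<in> sector j. circle_point p t \<in> P}"
    by (rule inj_onI, rule circle_point_inj) (use sector_subset[OF assms(2)] in blast)+
  show "circle_point p ` {t \<in> sector j. circle_point p t \<in> P} \<subseteq> P" by blast
qed (rule assms(1))

text \<open>Every angle except the largest starts an arc to the next one; the exception gives the
  summand 1.\<close>

lemma card_sector_angles_le:
  assumes P: "finite P" and j: "j < 12" and p: "p \<in> P"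
  shows "card {t \<in> sector j. circle_point p t \<in> P} \<le> card {e \<in> sector_arcs P j. fst e = p} + 1"
proof -
  let ?A = "{t \<in> sector j. circle_point p t \<in> P}" and ?E = "{e \<in> sector_arcs P j. fst e = p}"
  have finA: "finite ?A" by (rule finite_sector_angles[OF P j])
  define nxt where "nxt t = Min {b \<in> ?A. t < b}" for t
  define arc where "arc t = (p, circle_point p t, circle_point p (nxt t))" for t
  have nxt: "nxt t \<in> ?A \<and> t < nxt t \<and> (\<forall>b\<in>?A. t < b \<longrightarrow> nxt t \<le> b)" if "t \<in> ?A - {Max ?A}" for t
  proof -
    have ne: "{b \<in> ?A. t < b} \<noteq> {}"
      using that Max_in[OF finA] Max_ge[OF finA, of t] by fastforce
    have fin: "finite {b \<in> ?A. t < b}" by (rule finite_subset[OF _ finA]) blast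
    show ?thesis unfolding nxt_def using Min_in[OF fin ne] Min_le[OF fin] by blast
  qed
  have "card (?A - {Max ?A}) \<le> card ?E"
  proof (rule card_inj_on_le)
    show "inj_on arc (?A - {Max ?A})"
    proof (rule inj_onI)
      fix s t assume s: "s \<in> ?A - {Max ?A}" and t: "t \<in> ?A - {Max ?A}" and "arc s = arc t"
      then have "circle_point p s = circle_point p t" by (simp add: arc_def)
      then show "s = t" using s t sector_subset[OF j] by (intro circle_point_inj[of p]) blast+
    qed
    show "finite ?E" using finite_sector_arcs[OF P] by simp
    show "arc ` (?A - {Max ?A}) \<subseteq> ?E"
    proof (rule image_subsetI)
      fix t assume t: "t \<in> ?A - {Max ?A}"
      have "circle_point p s \<notin> P" if "t < s" "s < nxt t" for s
      proof
        assume "circle_point p s \<in> P"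
        moreover have "s \<in> sector j" using t nxt[OF t] that by (auto simp: sector_def)
        ultimately show False using nxt[OF t] that by force
      qed
      then have "arc t \<in> sector_arcs P j"
        unfolding arc_def sector_arcs_def using nxt[OF t] t p by blast
      then show "arc t \<in> ?E" by (simp add: arc_def)
    qed
  qed
  moreover have "card ?A - 1 \<le> card (?A - {Max ?A})"
    using diff_card_le_card_Diff[of "{Max ?A}" ?A] by simp
  ultimately show ?thesis by linarith
qed

lemma card_unit_circle_le:
  assumes P: "finite P" and p: "p \<in> P"
  shows "card {q \<in> P. dist p q = 1} \<le> (\<Sum>j<12. card {e \<in> sector_arcs P j. fst e = p}) + 12"
proof -
  let ?A = "\<lambda>j. {t \<in> sector j. circle_point p t \<in> P}"
  have fin: "finite (\<Union>j<12. ?A j)" using finite_sector_angles[OF P] by simp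
  have "{q \<in> P. dist p q = 1} \<subseteq> circle_point p ` (\<Union>j<12. ?A j)"
  proof
    fix q assume q: "q \<in> {q \<in> P. dist p q = 1}"
    then obtain t where t: "0 \<le> t" "t < 2 * pi" "q = circle_point p t" using circle_point_surj by blast
    define j where "j = nat \<lfloor>t / (pi / 6)\<rfloor>"
    have j: "real j \<le> t / (pi / 6)" "t / (pi / 6) < real j + 1"
      unfolding j_def using t(1) by (auto simp: of_nat_nat)
    have "t / (pi / 6) < 12" using t by (simp add: field_simps)
    then have "j < 12" using j(1) by linarith
    moreover have "t \<in> sector j" using j by (simp add: sector_def field_simps)
    ultimately show "q \<in> circle_point p ` (\<Union>j<12. ?A j)" using q t(3) by blast
  qed
  then have "card {q \<in> P. dist p q = 1} \<le> card (circle_point p ` (\<Union>j<12. ?A j))"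
    using fin by (intro card_mono) auto
  also have "\<dots> \<le> card (\<Union>j<12. ?A j)" by (rule card_image_le[OF fin])
  also have "\<dots> \<le> (\<Sum>j<12. card (?A j))" by (rule card_UN_le) simp
  also have "\<dots> \<le> (\<Sum>j<12. card {e \<in> sector_arcs P j. fst e = p} + 1)"
    by (intro sum_mono card_sector_angles_le[OF P _ p]) simp
  also have "\<dots> = (\<Sum>j<12. card {e \<in> sector_arcs P j. fst e = p}) + 12"
    by (simp only: sum.distrib) simp
  finally show ?thesis .
qed

lemma card_eq_sum_fibres:
  assumes "finite A" "finite B" "f ` A \<subseteq> B"
  shows "card A = (\<Sum>b\<in>B. card {a \<in> A. f a = b})"
  using sum.group[OF assms, of "\<lambda>_. 1::nat"] by simp

lemma card_unit_distance_pairs_le: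
  assumes P: "finite P"
  shows "card (unit_distance_pairs P) \<le> (\<Sum>j<12. card (sector_arcs P j)) + 12 * card P"
proof -
  let ?U = "SIGMA p:P. {q \<in> P. dist p q = 1}"
  have "unit_distance_pairs P = (\<lambda>(x, y). {x, y}) ` ?U"
    unfolding unit_distance_pairs_def by auto
  then have "card (unit_distance_pairs P) \<le> card ?U"
    using P by (simp only:) (intro card_image_le, auto)
  also have "\<dots> = (\<Sum>p\<in>P. card {q \<in> P. dist p q = 1})"
    using P by (simp add: card_SigmaI)
  also have "\<dots> \<le> (\<Sum>p\<in>P. (\<Sum>j<12. card {e \<in> sector_arcs P j. fst e = p}) + 12)"
    by (intro sum_mono card_unit_circle_le[OF P])
  also have "\<dots> = (\<Sum>j<12. \<Sum>p\<in>P. card {e \<in> sector_arcs P j. fst e = p}) + 12 * card P"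
    unfolding sum.distrib sum.swap[of _ P "{..<12}"] by simp
  also have "(\<Sum>j<12. \<Sum>p\<in>P. card {e \<in> sector_arcs P j. fst e = p}) = (\<Sum>j<12. card (sector_arcs P j))"
  proof (rule sum.cong[OF refl])
    fix j
    have sub: "fst ` sector_arcs P j \<subseteq> P" by (auto simp: sector_arcs_def)
    show "(\<Sum>p\<in>P. card {e \<in> sector_arcs P j. fst e = p}) = card (sector_arcs P j)"
      by (rule card_eq_sum_fibres[OF finite_sector_arcs[OF P] P sub, symmetric])
  qed
  finally show ?thesis .
qed

section \<open>Counting arcs by their lunes\<close>

text \<open>The lune sum divided by \<open>m ^ 2\<close> is at most half of \<open>card D\<close>;
  absorbing it on the left doubles the main term.\<close>

lemma sector_arcs_low:
  assumes P: "finite P" and D: "D \<subseteq> sector_arcs P j" and m: "m > (0::nat)" "2 * k \<le> real m ^ 2"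
    and low: "\<And>e. e \<in> D \<Longrightarrow> real (card (lunes (fst (snd e)) (snd (snd e)) \<inter> P)) \<le> k"
  shows "real (card D) \<le> 6 * real (card P) * real m"
proof -
  have sub: "fst ` D \<subseteq> P" using D by (auto simp: sector_arcs_def)
  have "(\<Sum>e\<in>D. real (card (lunes (fst (snd e)) (snd (snd e)) \<inter> P))) \<le> real (card D) * k"
    by (rule sum_bounded_above[OF low])
  also have "\<dots> \<le> real (card D) * (real m ^ 2 / 2)" using m(2) by (intro mult_left_mono) auto
  finally have "(\<Sum>e\<in>D. real (card (lunes (fst (snd e)) (snd (snd e)) \<inter> P))) / real m ^ 2 \<le> real (card D) / 2"
    using m(1) by (simp add: field_simps)
  then show ?thesis using sector_arcs_bound[OF P D order_refl sub m(1)] by linarith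
qed

text \<open>Averaging against the total lune sum of at most \<open>2 * (card P) ^ 2\<close>.\<close>

lemma sector_arcs_high:
  assumes P: "finite P" and D: "D \<subseteq> sector_arcs P j" and K: "K > 0"
    and high: "\<And>e. e \<in> D \<Longrightarrow> K \<le> real (card (lunes (fst (snd e)) (snd (snd e)) \<inter> P))"
  shows "real (card D) \<le> 2 * real (card P) ^ 2 / K"
proof -
  have sub: "fst ` D \<subseteq> P" using D by (auto simp: sector_arcs_def)
  have "real (card D) * K \<le> (\<Sum>e\<in>D. real (card (lunes (fst (snd e)) (snd (snd e)) \<inter> P)))"
    by (rule sum_bounded_below[OF high])
  also have "\<dots> \<le> 2 * real (card P) ^ 2"
    using of_nat_mono[OF sector_lunes_sum[OF P D order_refl sub], where ?'a = real] by simp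
  finally show ?thesis using K by (simp add: field_simps)
qed

text \<open>Crossings need centres in \<open>T\<close>, so only lune points in \<open>T\<close>
  count and their total is quadratic in \<open>card T\<close>. If \<open>T\<close> is a small
  fraction of \<open>n\<close> points and \<open>m\<close> has order \<open>n powr (1/3)\<close>,
  the last summand is a small multiple of \<open>n powr (4/3)\<close>.\<close>

lemma sector_arcs_few_centres:
  assumes P: "finite P" and D: "D \<subseteq> sector_arcs P j" and T: "T \<subseteq> P" "fst ` D \<subseteq> T" and m: "m > (0::nat)"
  shows "real (card D) \<le> 3 * real (card P) * real m + 2 * real (card T) ^ 2 / real m ^ 2"
proof -
  have "(\<Sum>e\<in>D. real (card (lunes (fst (snd e)) (snd (snd e)) \<inter> T))) \<le> 2 * real (card T) ^ 2"
    using of_nat_mono[OF sector_lunes_sum[OF P D T], where ?'a = real] by simp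
  then have "(\<Sum>e\<in>D. real (card (lunes (fst (snd e)) (snd (snd e)) \<inter> T))) / real m ^ 2
      \<le> 2 * real (card T) ^ 2 / real m ^ 2"
    by (rule divide_right_mono) simp
  then show ?thesis using sector_arcs_bound[OF P D T m] by linarith
qed

definition good_pairs :: "real \<Rightarrow> real \<Rightarrow> (real ^ 2) set \<Rightarrow> real ^ 2 \<Rightarrow> (real ^ 2) set set" where
  "good_pairs k K P p = {{q, r} | q r. consecutive_on_circle P p q r \<and> dist q r < 1 \<and>
     k \<le> real (card (lunes q r \<inter> P)) \<and> real (card (lunes q r \<inter> P)) \<le> K}"

lemma card_good_arcs_le:
  assumes P: "finite P" and j: "j < 12"
  shows "card {e \<in> sector_arcs P j. fst e = p \<and> k \<le> real (card (lunes (fst (snd e)) (snd (snd e)) \<inter> P)) \<and>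
      real (card (lunes (fst (snd e)) (snd (snd e)) \<inter> P)) \<le> K} \<le> card (good_pairs k K P p)"
    (is "card ?A \<le> _")
proof (rule card_inj_on_le)
  show "inj_on (\<lambda>e. {fst (snd e), snd (snd e)}) ?A"
    by (rule inj_on_subset[OF inj_on_endpoints[OF P order_refl order_refl]])
      (auto simp: sector_arcs_def)
  show "(\<lambda>e. {fst (snd e), snd (snd e)}) ` ?A \<subseteq> good_pairs k K P p"
  proof (rule image_subsetI)
    fix e assume e: "e \<in> ?A"
    then have "(p, fst (snd e), snd (snd e)) \<in> sector_arcs P j" by auto
    from sector_arc_consecutive[OF j this] e
    show "{fst (snd e), snd (snd e)} \<in> good_pairs k K P p" unfolding good_pairs_def by blast
  qed
  have "good_pairs k K P p \<subseteq> Pow P"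
    unfolding good_pairs_def consecutive_on_circle_def next_on_circle_def by auto
  then show "finite (good_pairs k K P p)" using P by (simp add: finite_subset)
qed

text \<open>Arcs fall into four classes: few lune points, many lune points, and otherwise centre in
  \<open>T\<close> or outside \<open>T\<close>, where a centre carries fewer than \<open>g\<close>
  good pairs. The coefficient 9 is 6 from the first class plus 3 from the third.\<close>

lemma card_sector_arcs_le:
  fixes g :: real
  assumes P: "finite P" and j: "j < 12" and m: "m > (0::nat)" "2 * k \<le> real m ^ 2" and K: "K > 0" and g: "g \<ge> 0"
  defines "T \<equiv> {p \<in> P. g \<le> real (card (good_pairs k K P p))}"
  shows "real (card (sector_arcs P j)) \<le> 9 * real (card P) * real m + 2 * real (card P) ^ 2 / K
    + 2 * real (card T) ^ 2 / real m ^ 2 + real (card P) * g"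
proof -
  let ?E = "sector_arcs P j"
  let ?c = "\<lambda>e. real (card (lunes (fst (snd e)) (snd (snd e)) \<inter> P))"
  let ?L = "{e \<in> ?E. ?c e < k}" and ?H = "{e \<in> ?E. K < ?c e}"
  let ?G = "{e \<in> ?E. k \<le> ?c e \<and> ?c e \<le> K}"
  let ?GT = "{e \<in> ?G. fst e \<in> T}" and ?GN = "{e \<in> ?G. fst e \<in> P - T}"
  have fin: "finite ?E" by (rule finite_sector_arcs[OF P])
  have sub: "fst ` ?E \<subseteq> P" by (auto simp: sector_arcs_def)
  have TP: "T \<subseteq> P" by (auto simp: T_def)
  have low: "real (card ?L) \<le> 6 * real (card P) * real m"
    by (rule sector_arcs_low[OF P _ m, of _ j]) auto
  have high: "real (card ?H) \<le> 2 * real (card P) ^ 2 / K"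
    by (rule sector_arcs_high[OF P _ K, of _ j]) auto
  have GT: "real (card ?GT) \<le> 3 * real (card P) * real m + 2 * real (card T) ^ 2 / real m ^ 2"
    by (rule sector_arcs_few_centres[OF P _ TP _ m(1), of _ j]) auto
  have "card ?GN = (\<Sum>p\<in>P - T. card {e \<in> ?GN. fst e = p})"
    by (rule card_eq_sum_fibres) (use P finite_subset[OF _ fin] in auto)
  also have "real \<dots> \<le> (\<Sum>p\<in>P - T. g)"
    unfolding of_nat_sum
  proof (rule sum_mono)
    fix p assume p: "p \<in> P - T"
    have "card {e \<in> ?GN. fst e = p} \<le> card {e \<in> ?E. fst e = p \<and> k \<le> ?c e \<and> ?c e \<le> K}"
      by (rule card_mono[OF finite_subset[OF _ fin]]) auto
    also have "\<dots> \<le> card (good_pairs k K P p)" by (rule card_good_arcs_le[OF P j])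
    finally have "real (card {e \<in> ?GN. fst e = p}) \<le> real (card (good_pairs k K P p))"
      by (rule of_nat_mono)
    moreover have "real (card (good_pairs k K P p)) < g" using p by (auto simp: T_def)
    ultimately show "real (card {e \<in> ?GN. fst e = p}) \<le> g" by linarith
  qed
  also have "\<dots> \<le> real (card P) * g"
    using card_mono[OF P, of "P - T"] g by (simp add: mult_right_mono)
  finally have GN: "real (card ?GN) \<le> real (card P) * g" .
  have "?E \<subseteq> ((?L \<union> ?H) \<union> ?GT) \<union> ?GN"
  proof
    fix e assume e: "e \<in> ?E"
    then have "fst e \<in> P" using sub by blast
    moreover have "?c e < k \<or> K < ?c e \<or> k \<le> ?c e \<and> ?c e \<le> K" by linarith
    ultimately show "e \<in> ((?L \<union> ?H) \<union> ?GT) \<union> ?GN" using e by blast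
  qed
  moreover have "finite (((?L \<union> ?H) \<union> ?GT) \<union> ?GN)" by (rule finite_subset[OF _ fin]) blast
  ultimately have "card ?E \<le> card (((?L \<union> ?H) \<union> ?GT) \<union> ?GN)" by (rule card_mono[rotated])
  then have "card ?E \<le> card ?L + card ?H + card ?GT + card ?GN"
    using card_Un_le[of "(?L \<union> ?H) \<union> ?GT" ?GN] card_Un_le[of "?L \<union> ?H" ?GT] card_Un_le[of ?L ?H] by linarith
  then have "real (card ?E) \<le> real (card ?L) + real (card ?H) + real (card ?GT) + real (card ?GN)"
    by linarith
  with low high GT GN show ?thesis by linarith
qed

theorem proposition1p5:
  fixes c1 :: real
  assumes "c1 > 0"
  shows "\<exists>(c4::real) (c5::real) (c5'::real) (c6::real) (n0::nat).
    c4 > 0 \<and> c5 > 0 \<and> c5' > 0 \<and> c6 > 0 \<and> n0 > 0 \<and>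
    (\<forall>n\<ge>n0. \<forall>P :: (real ^ 2) set.
       finite P \<and> card P = n \<and>
       real (card (unit_distance_pairs P)) \<ge> c1 * real n powr (4/3) \<longrightarrow>
       real (card {p \<in> P. typical c4 c5 c5' P p}) \<ge> c6 * real n)"
proof -
  \<comment> \<open>The constants make each of the four error terms in
    \<open>card_sector_arcs_le\<close> equal to \<open>c1 / 96 * \<beta> ^ 4\<close> up to lower
    order, with \<open>\<beta> = n powr (1/3)\<close> and \<open>m\<close> about
    \<open>\<mu> * \<beta>\<close>; here \<open>864 = 9 * 96\<close>. Twelve sectors then yield only
    half of the assumed \<open>c1 * \<beta> ^ 4\<close>. The choice of \<open>c5\<close> gives
    \<open>2 * c5 * \<beta> ^ 2 = (\<mu> * \<beta>) ^ 2\<close>.\<close>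
  define \<mu> where "\<mu> = c1 / 864"
  define c4 c5 c5' c6 where "c4 = c1 / 96" and "c5 = \<mu>\<^sup>2 / 2" and "c5' = 192 / c1"
    and "c6 = \<mu> * sqrt (c1 / 192)"
  \<comment> \<open>Ensures \<open>c1 * \<beta> \<ge> 480\<close>, beyond the bound 240 derived at
    the end; the summand 1 makes \<open>n\<close> positive.\<close>
  define n0 where "n0 = nat \<lceil>(480 / c1) ^ 3\<rceil> + 1"
  have \<mu>: "\<mu> > 0" using assms by (simp add: \<mu>_def)
  have pos: "c4 > 0" "c5 > 0" "c5' > 0" "c6 > 0" "n0 > 0"
    using assms \<mu> by (simp_all add: c4_def c5_def c5'_def c6_def n0_def)
  have "c6 * real n \<le> real (card {p \<in> P. typical c4 c5 c5' P p})"
    if n: "n \<ge> n0" and P: "finite P" "card P = n"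
      and many: "real (card (unit_distance_pairs P)) \<ge> c1 * real n powr (4/3)"
    for n :: nat and P :: "(real ^ 2) set"
  proof (rule ccontr)
    define T where "T = {p \<in> P. typical c4 c5 c5' P p}"
    assume "\<not> ?thesis"
    then have few: "real (card T) < c6 * real n" by (simp add: T_def)
    define \<beta> where "\<beta> = real n powr (1/3)"
    have n1: "n \<ge> 1" using n pos by simp
    have \<beta>: "\<beta> > 0" using n1 by (simp add: \<beta>_def)
    have \<beta>_pow: "\<beta> ^ k = real n powr (real k / 3)" for k
      using n1 by (simp add: \<beta>_def powr_powr flip: powr_realpow)
    have \<beta>3: "real n = \<beta> ^ 3" and \<beta>2: "real n powr (2/3) = \<beta> ^ 2" and \<beta>4: "real n powr (4/3) = \<beta> ^ 4"
      using n1 by (simp_all add: \<beta>_pow)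
    have "(480 / c1) ^ 3 \<le> real n"
      using n real_nat_ceiling_ge[of "(480 / c1) ^ 3"] unfolding n0_def by linarith
    then have "(480 / c1) ^ 3 \<le> \<beta> ^ 3" unfolding \<beta>3 .
    moreover have "(480 / c1) ^ 3 \<le> \<beta> ^ 3 \<longleftrightarrow> 480 / c1 \<le> \<beta>"
      by (rule power_mono_iff) (use assms \<beta> in simp_all)
    ultimately have large: "480 / c1 \<le> \<beta>" by blast
    \<comment> \<open>Rounding up adds at most 1, which causes the lower order term
      \<open>9 * \<beta> ^ 3\<close> in each sector.\<close>
    define m where "m = nat \<lceil>\<mu> * \<beta>\<rceil>"
    have m: "\<mu> * \<beta> \<le> real m" "real m \<le> \<mu> * \<beta> + 1"
      using \<mu> \<beta> by (simp_all add: m_def real_nat_ceiling_ge of_nat_nat)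
    have "0 < real m" using m(1) mult_pos_pos[OF \<mu> \<beta>] by linarith
    then have m0: "m > 0" by simp
    have m2: "(\<mu> * \<beta>)\<^sup>2 \<le> real m ^ 2" using m(1) \<mu> \<beta> by (intro power_mono) auto
    have T_eq: "T = {p \<in> P. c4 * \<beta> \<le> real (card (good_pairs (c5 * \<beta> ^ 2) (c5' * \<beta> ^ 2) P p))}"
      unfolding T_def typical_def good_pairs_def P(2) \<beta>2 \<beta>_def[symmetric] by blast
    have "2 * (c5 * \<beta> ^ 2) \<le> real m ^ 2" using m2 by (simp add: c5_def power_mult_distrib)
    moreover have "c5' * \<beta> ^ 2 > 0" "c4 * \<beta> \<ge> 0" using pos \<beta> by simp_all
    ultimately have sector: "real (card (sector_arcs P j)) \<le> 9 * \<beta> ^ 3 * real m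
        + 2 * (\<beta> ^ 3) ^ 2 / (c5' * \<beta> ^ 2) + 2 * real (card T) ^ 2 / real m ^ 2 + \<beta> ^ 3 * (c4 * \<beta>)"
      if "j < 12" for j
      using card_sector_arcs_le[OF P(1) that m0, of "c5 * \<beta> ^ 2" "c5' * \<beta> ^ 2" "c4 * \<beta>", folded T_eq]
      unfolding P(2) \<beta>3 by blast
    have "2 * (\<beta> ^ 3) ^ 2 / (c5' * \<beta> ^ 2) = c1 / 96 * \<beta> ^ 4"
      using \<beta> assms by (simp add: c5'_def field_simps eval_nat_numeral)
    moreover have "\<beta> ^ 3 * (c4 * \<beta>) = c1 / 96 * \<beta> ^ 4"
      by (simp add: c4_def eval_nat_numeral)
    moreover have "9 * \<beta> ^ 3 * real m \<le> c1 / 96 * \<beta> ^ 4 + 9 * \<beta> ^ 3"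
    proof -
      have "9 * \<beta> ^ 3 * real m \<le> 9 * \<beta> ^ 3 * (\<mu> * \<beta> + 1)" using m(2) \<beta> by (intro mult_left_mono) auto
      also have "\<dots> = c1 / 96 * \<beta> ^ 4 + 9 * \<beta> ^ 3" by (simp add: \<mu>_def field_simps eval_nat_numeral)
      finally show ?thesis .
    qed
    moreover have "2 * real (card T) ^ 2 / real m ^ 2 \<le> c1 / 96 * \<beta> ^ 4"
    proof -
      have "real (card T) ^ 2 \<le> (c6 * \<beta> ^ 3) ^ 2" using few unfolding \<beta>3 by (intro power_mono) auto
      then have "2 * real (card T) ^ 2 / real m ^ 2 \<le> 2 * (c6 * \<beta> ^ 3) ^ 2 / (\<mu> * \<beta>)\<^sup>2"
        using m2 \<mu> \<beta> by (intro frac_le) auto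
      also have "\<dots> = 2 * (sqrt (c1 / 192))\<^sup>2 * \<beta> ^ 4"
        using \<mu> \<beta> by (simp add: c6_def power_mult_distrib field_simps eval_nat_numeral del: real_sqrt_divide)
      also have "\<dots> = c1 / 96 * \<beta> ^ 4" using assms by simp
      finally show ?thesis .
    qed
    ultimately have bound: "real (card (sector_arcs P j)) \<le> c1 / 24 * \<beta> ^ 4 + 9 * \<beta> ^ 3" if "j < 12" for j
      using sector[OF that] by linarith
    have "c1 * \<beta> ^ 4 \<le> real (card (unit_distance_pairs P))" using many unfolding \<beta>4 .
    also have "\<dots> \<le> (\<Sum>j<12. real (card (sector_arcs P j))) + 12 * \<beta> ^ 3"
      using of_nat_mono[OF card_unit_distance_pairs_le[OF P(1)], where ?'a = real] unfolding P(2) by (simp add: \<beta>3)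
    also have "(\<Sum>j<12. real (card (sector_arcs P j))) \<le> (\<Sum>j<12::nat. c1 / 24 * \<beta> ^ 4 + 9 * \<beta> ^ 3)"
      by (intro sum_mono bound) simp
    also have "\<dots> = c1 / 2 * \<beta> ^ 4 + 108 * \<beta> ^ 3" by simp
    \<comment> \<open>The 120 is 108 from rounding \<open>m\<close> in twelve sectors plus 12 from
      the points lost at sector ends.\<close>
    finally have "c1 / 2 * \<beta> ^ 4 \<le> 120 * \<beta> ^ 3" by linarith
    moreover have "\<beta> ^ 4 = \<beta> ^ 3 * \<beta>" by (simp add: eval_nat_numeral)
    ultimately have "\<beta> ^ 3 * (c1 * \<beta>) \<le> \<beta> ^ 3 * 240" by (simp add: ac_simps)
    then have "c1 * \<beta> \<le> 240" using \<beta> by (subst (asm) mult_le_cancel_left_pos) auto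
    moreover have "480 \<le> c1 * \<beta>" using large assms by (simp add: field_simps)
    ultimately show False by simp
  qed
  then show ?thesis using pos by blast
qed

end
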